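(* Let $k \ge 1$ be a fixed integer, and for each $n \ge 1$ let $R_n$ be the length of the path from node $n$ to the root $0$ obtained by following first parents in the uniform random $k$-dag. Then, as $n \to \infty$, $$\frac{R_n}{\log n} \to 1 \quad \text{in probability},$$ $$\frac{\max_{1 \le \ell \le n} R_\ell}{\log n} \to e \quad \text{in probability},$$ and $$\lim_{n \to \infty} \mathbb{P}\left\{ \min_{n/2 \le \ell \le n} R_\ell \le 2 \right\} = 1.$$ Finally, for every integer $n \ge 2$ and every integer $t \ge \log n$, $$\mathbb{P}\{ R_n > t \} \le \exp\left( t - \log n - t \log (t/\log n) \right).$$
   Context: The uniform random $k$-dag is the infinite random directed acyclic graph on the non-negative integers defined as follows: node $0$ is the root, and each node $m = 1, 2, \ldots$ independently chooses an ordered list of $k$ parents (first parent, ..., $k$-th parent), independently and uniformly with replacement from $\{0, 1, \ldots, m-1\}$; there is an edge from $m$ to each of its parents. For a node $n$, let $P_n$ be the path from $n$ to $0$ obtained by repeatedly moving from the current node to its first parent until $0$ is reached, and let $R_n$ be the length (number of edges) of $P_n$. Thus the joint law of $(R_n)_{n \ge 1}$ does not depend on $k$. Here $\log$ is the natural logarithm, and the index $\ell$ in the maximum and minimum ranges over integers. *)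

theory Defs
  imports "HOL-Probability.Probability"
begin

text \<open>\<open>par m i\<close> is the \<open>i\<close>-th parent of node \<open>m\<close>, with positions counted from \<open>0\<close>; the
  first parent is \<open>par m 0\<close>.  The values \<open>par 0 i\<close> (the root has no parents) and \<open>par m i\<close>
  for \<open>i \<ge> k\<close> are unconstrained.\<close>

locale uniform_random_kdag = prob_space M for M :: "'a measure" +
  fixes k :: nat and par :: "nat \<Rightarrow> nat \<Rightarrow> 'a \<Rightarrow> nat"
  assumes indep_par:
      "indep_vars (\<lambda>(m, i). count_space {..<m}) (\<lambda>(m, i). par m i) ({1..} \<times> {..<k})"
    and distr_par: "\<And>m i. m \<ge> 1 \<Longrightarrow> i < k \<Longrightarrow>
      distr M (count_space {..<m}) (par m i) = uniform_count_measure {..<m}"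

definition path_length :: "(nat \<Rightarrow> nat \<Rightarrow> 'a \<Rightarrow> nat) \<Rightarrow> nat \<Rightarrow> 'a \<Rightarrow> nat" where
  "path_length par n \<omega> = (LEAST j. ((\<lambda>m. par m 0 \<omega>) ^^ j) n = 0)"

definition converges_in_prob :: "'a measure \<Rightarrow> (nat \<Rightarrow> 'a \<Rightarrow> real) \<Rightarrow> real \<Rightarrow> bool" where
  "converges_in_prob M X c \<longleftrightarrow>
     (\<forall>n. X n \<in> borel_measurable M) \<and>
     (\<forall>\<epsilon>>0. (\<lambda>n. measure M {\<omega> \<in> space M. \<bar>X n \<omega> - c\<bar> > \<epsilon>}) \<longlonglongrightarrow> 0)"

text \<open>Parents are smaller than their child at every sample point, so first parents always lead
  to the root and the \<open>LEAST\<close> above is attained.\<close>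

context uniform_random_kdag
begin

lemma par_measurable:
  assumes "m \<ge> 1" "i < k"
  shows "par m i \<in> measurable M (count_space {..<m})"
proof -
  have "(case (m, i) of (m, i) \<Rightarrow> random_variable (count_space {..<m}) (par m i))"
    using indep_par assms unfolding indep_vars_def by fastforce
  then show ?thesis by simp
qed

lemma par_less:
  assumes "m \<ge> 1" "i < k" "\<omega> \<in> space M"
  shows "par m i \<omega> < m"
  using measurable_space[OF par_measurable[OF assms(1,2)] assms(3)] by simp

lemma first_parents_reach_root:
  assumes "k \<ge> 1" "\<omega> \<in> space M"
  shows "\<exists>j. ((\<lambda>m. par m 0 \<omega>) ^^ j) n = 0"
proof (induction n rule: less_induct)
  case (less n)
  show ?case
  proof (cases "n = 0")
    case True
    then show ?thesis by (intro exI[of _ 0]) simp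
  next
    case False
    then have "par n 0 \<omega> < n" using par_less assms by simp
    then obtain j where "((\<lambda>m. par m 0 \<omega>) ^^ j) (par n 0 \<omega>) = 0" using less by blast
    then have "((\<lambda>m. par m 0 \<omega>) ^^ Suc j) n = 0" by (simp add: funpow_Suc_right del: funpow.simps)
    then show ?thesis by blast
  qed
qed

lemma path_length_root [simp]: "path_length par 0 \<omega> = 0"
  by (simp add: path_length_def)

lemma path_length_step:
  assumes "k \<ge> 1" "\<omega> \<in> space M" "n \<ge> 1"
  shows "path_length par n \<omega> = Suc (path_length par (par n 0 \<omega>) \<omega>)"
proof -
  obtain j where "((\<lambda>m. par m 0 \<omega>) ^^ j) n = 0"
    using first_parents_reach_root[OF assms(1,2)] by blast
  then have "(LEAST j. ((\<lambda>m. par m 0 \<omega>) ^^ j) n = 0)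
      = Suc (LEAST j. ((\<lambda>m. par m 0 \<omega>) ^^ Suc j) n = 0)"
    by (rule Least_Suc) (use assms in simp)
  then show ?thesis by (simp add: path_length_def funpow_Suc_right del: funpow.simps)
qed

lemma path_length_measurable:
  assumes "k \<ge> 1"
  shows "path_length par n \<in> measurable M (count_space UNIV)"
proof (induction n rule: less_induct)
  case (less n)
  show ?case
  proof (cases "n = 0")
    case True
    then have "path_length par n = (\<lambda>_. 0)" by (auto simp: fun_eq_iff path_length_def)
    then show ?thesis by simp
  next
    case False
    have p: "par n 0 \<in> measurable M (count_space {..<n})"
      using par_measurable[of n 0] assms False by simp
    have "(\<lambda>\<omega>. Suc (path_length par (par n 0 \<omega>) \<omega>)) \<in> measurable M (count_space UNIV)"
      by (rule measurable_compose_countable'[OF _ p])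
         (auto intro!: measurable_compose[OF less] simp: countable_finite)
    moreover have "\<And>\<omega>. \<omega> \<in> space M \<Longrightarrow>
        path_length par n \<omega> = Suc (path_length par (par n 0 \<omega>) \<omega>)"
      using path_length_step assms False by simp
    ultimately show ?thesis by (subst measurable_cong)
  qed
qed

end

text \<open>Such a random structure exists: take the coordinates of the product measure.\<close>

lemma uniform_random_kdag_exists:
  assumes "k \<ge> 1"
  shows "uniform_random_kdag
     (PiM ({1..} \<times> {..<k}) (\<lambda>(m, i). uniform_count_measure {..<m})) k (\<lambda>m i \<omega>. \<omega> (m, i))"
proof -
  let ?I = "{1::nat..} \<times> {..<k}"
  let ?N = "\<lambda>(m::nat, i::nat). uniform_count_measure {..<m}"
  let ?C = "\<lambda>(m::nat, i::nat). count_space {..<m}"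
  let ?P = "PiM ?I ?N"
  have prob: "prob_space (?N p)" if "p \<in> ?I" for p
    using that by (auto intro!: prob_space_uniform_count_measure simp: lessThan_empty_iff)
  interpret P: prob_space ?P
    by (rule prob_space_PiM) (rule prob)
  have sets: "sets (?N p) = sets (?C p)" for p
    by (auto simp: sets_uniform_count_measure split: prod.split)
  have comp: "distr ?P (?C p) (\<lambda>\<omega>. \<omega> p) = ?N p" if "p \<in> ?I" for p
  proof -
    have "distr ?P (?C p) (\<lambda>\<omega>. \<omega> p) = distr ?P (?N p) (\<lambda>\<omega>. \<omega> p)"
      by (rule distr_cong) (simp_all add: sets)
    also have "\<dots> = ?N p"
      using distr_PiM_component[of ?I ?N p] prob that by blast
    finally show ?thesis .
  qed
  have meas: "(\<lambda>\<omega>. \<omega> p) \<in> measurable ?P (?C p)" if "p \<in> ?I" for p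
    using measurable_component_singleton[OF that, of ?N] measurable_cong_sets[OF refl sets[of p]]
    by blast
  have "P.indep_vars ?C (\<lambda>p \<omega>. \<omega> p) ?I"
  proof -
    have "(1, 0) \<in> ?I" using assms by simp
    then have "?I \<noteq> {}" by blast
    moreover have "distr ?P (PiM ?I ?C) (\<lambda>\<omega>. \<lambda>p\<in>?I. \<omega> p)
        = PiM ?I (\<lambda>p. distr ?P (?C p) (\<lambda>\<omega>. \<omega> p))"
    proof -
      have "distr ?P (PiM ?I ?C) (\<lambda>\<omega>. \<lambda>p\<in>?I. \<omega> p) = distr ?P ?P (\<lambda>\<omega>. \<omega>)"
      proof (rule distr_cong)
        show "sets (PiM ?I ?C) = sets ?P"
          by (rule sets_PiM_cong) (simp_all only: sets)
        show "(\<lambda>p\<in>?I. \<omega> p) = \<omega>" if "\<omega> \<in> space ?P" for \<omega>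
          using that unfolding space_PiM by (rule PiE_restrict)
      qed simp
      also have "\<dots> = ?P" by (rule distr_id)
      also have "\<dots> = PiM ?I (\<lambda>p. distr ?P (?C p) (\<lambda>\<omega>. \<omega> p))"
        by (rule PiM_cong) (simp_all only: comp)
      finally show ?thesis .
    qed
    ultimately show ?thesis
      using P.indep_vars_iff_distr_eq_PiM'[of ?I "\<lambda>p \<omega>. \<omega> p" ?C] meas by blast
  qed
  then have "P.indep_vars ?C (\<lambda>(m, i) \<omega>. \<omega> (m, i)) ?I"
    by (simp add: case_prod_unfold)
  moreover have "distr ?P (count_space {..<m}) (\<lambda>\<omega>. \<omega> (m, i)) = uniform_count_measure {..<m}"
    if "m \<ge> 1" "i < k" for m i
    using comp[of "(m, i)"] that by simp
  ultimately show ?thesis by unfold_locales auto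
qed

end

theory Submission
  imports Defs
begin

text \<open>
  First parents form a random recursive tree: the path length of node \<open>n\<close> is its depth, and
  node \<open>n\<close> hangs below a node chosen uniformly from \<open>{0..<n}\<close>, independently of the past.

  \<^emph>\<open>Single node and upper bounds.\<close> Let \<open>S n\<close> be the sum of \<open>z ^ depth u\<close> over \<open>u < n\<close>.  Attaching node
  \<open>n\<close> multiplies its expectation by \<open>1 + z / n\<close>, so the expectation is an explicit product of order
  \<open>n powr z\<close>, and \<open>z ^ depth n\<close> has mean \<open>z / n\<close> times that product.  Markov's
  inequality with \<open>z = t / ln n\<close> is the tail bound; there the product is at most \<open>n powr z\<close> exactly,
  by Bernoulli's inequality.  With \<open>z = c\<close> the probability that the depth of \<open>n\<close> is on the far side of
  \<open>c * ln n\<close> is at most of order \<open>exp ((c - 1 - c * ln c) * ln n)\<close>, which vanishes for every \<open>c \<noteq> 1\<close>.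
  Markov's inequality for \<open>S (n + 1)\<close> itself at \<open>z = exp 1\<close> excludes depths above \<open>c * ln n\<close>
  when \<open>c > exp 1\<close> (\<open>max_path_length_upper\<close>).

  \<^emph>\<open>Lower bound for the maximum.\<close> Suppose that \<open>a\<close> nodes of depth at least \<open>r\<close> are present before time
  \<open>m\<close>.  Among the nodes born in the block \<open>{m..<b * m}\<close>, the \<open>k\<close>-th generation descending from
  these has about \<open>a * (ln b) ^ k / k!\<close> members on average, and its variance is at most
  \<open>a * b\<^sup>2\<close> (\<open>evolve_gen_deviation\<close>).  Since \<open>k!\<close> is roughly \<open>(k / e) ^ k\<close>, every \<open>c < e\<close> admits
  \<open>b\<close> and \<open>k\<close> with \<open>k \<ge> c * ln b\<close> and \<open>(ln b) ^ k / k! > 1\<close> (\<open>block_exists\<close>).  By Chebyshev's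
  inequality there are then at least \<open>\<theta> * a\<close> nodes of depth at least \<open>r + k\<close> at time \<open>b * m\<close>, with a fixed
  \<open>\<theta> > 1\<close>, except with probability of order \<open>1 / a\<close> (\<open>evolve_deep_count\<close>).  Start with all of the
  first \<open>m\<^sub>0\<close> nodes and \<open>r = 0\<close>.  The counts grow geometrically, so the failure probabilities of all
  blocks together are of order \<open>1 / m\<^sub>0\<close> (\<open>deep_count_growth\<close>), while each block raises the height by
  \<open>k \<ge> c * ln b\<close> as time grows by the factor \<open>b\<close>.  As \<open>m\<^sub>0\<close> is arbitrary, the height exceeds
  \<open>c * ln n\<close> with probability tending to \<open>1\<close>.

  \<^emph>\<open>Minimum.\<close> If the root has \<open>X\<close> children before time \<open>n / 2\<close>, each later node up to \<open>n\<close> is attached to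
  one of them with probability at least \<open>X / n\<close>; so, given \<open>X\<close>, all nodes in \<open>{n / 2..n}\<close> have depth above \<open>2\<close>
  with probability at most \<open>exp (- X / 2)\<close>.  The mean of this tends to \<open>0\<close>, because \<open>X\<close> is a sum of
  independent indicators with means \<open>1 / l\<close>, whose sum diverges.
\<close>

section \<open>Parent functions and depths\<close>

text \<open>The minimum replaces an illegal parent by the predecessor of the node.  So \<open>depth\<close> is total
  and can be computed for every parent function; on parent functions with \<open>p n < n\<close> it is the number of
  steps to \<open>0\<close>.\<close>

fun depth :: "(nat \<Rightarrow> nat) \<Rightarrow> nat \<Rightarrow> nat" where
  "depth p 0 = 0"
| "depth p (Suc n) = Suc (depth p (min n (p (Suc n))))"

lemma depth_cong:
  "(\<And>l. l \<le> n \<Longrightarrow> p l = q l) \<Longrightarrow> depth p n = depth q n"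
proof (induction n rule: less_induct)
  case (less n)
  show ?case
  proof (cases n)
    case (Suc n')
    have "depth p (min n' (p n)) = depth q (min n' (p n))"
      using Suc less by (intro less.IH) auto
    then show ?thesis using Suc less.prems[of n] by simp
  qed simp
qed

lemma depth_update_old [simp]: "v < n \<Longrightarrow> depth (p(n := u)) v = depth p v"
  by (rule depth_cong) simp

lemma depth_update_new [simp]: "u < n \<Longrightarrow> depth (p(n := u)) n = Suc (depth p u)"
  by (cases n) (simp_all add: min_absorb2)

section \<open>Averaging over the choices of parents\<close>

definition step_avg :: "nat \<Rightarrow> ((nat \<Rightarrow> nat) \<Rightarrow> real) \<Rightarrow> (nat \<Rightarrow> nat) \<Rightarrow> real" where
  "step_avg n f p = (\<Sum>u<n. f (p(n := u))) / real n"

text \<open>\<open>evolve m j f p\<close> is the conditional expectation of \<open>f\<close> applied to the parent function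
  at time \<open>m + j\<close>, given that it is \<open>p\<close> at time \<open>m\<close>.  All moment computations are made with this
  operator on finite sums, and only its connection with the measure space refers to integrals.\<close>

primrec evolve :: "nat \<Rightarrow> nat \<Rightarrow> ((nat \<Rightarrow> nat) \<Rightarrow> real) \<Rightarrow> (nat \<Rightarrow> nat) \<Rightarrow> real" where
  "evolve m 0 f = f"
| "evolve m (Suc j) f = evolve m j (step_avg (m + j) f)"

lemma step_avg_mono:
  "(\<And>u. u < n \<Longrightarrow> f (p(n := u)) \<le> g (p(n := u))) \<Longrightarrow> step_avg n f p \<le> step_avg n g p"
  unfolding step_avg_def by (intro divide_right_mono sum_mono) auto

text \<open>The evolution from time \<open>m\<close> changes only the parents of nodes from \<open>m\<close> on, so only
  parent functions that continue \<open>p\<close> are compared.  Depths of old nodes may thus be treated as constants.\<close>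

lemma evolve_mono:
  assumes "\<And>q. (\<And>l. l < m \<Longrightarrow> q l = p l) \<Longrightarrow> f q \<le> g q"
  shows "evolve m j f p \<le> evolve m j g p"
  using assms
proof (induction j arbitrary: f g)
  case (Suc j)
  show ?case unfolding evolve.simps
    by (rule Suc.IH, rule step_avg_mono, rule Suc.prems) auto
qed simp

lemma step_avg_linear:
  "step_avg n (\<lambda>p. c * f p + d * g p) p = c * step_avg n f p + d * step_avg n g p"
  unfolding step_avg_def by (simp add: sum.distrib sum_distrib_left add_divide_distrib)

lemma evolve_linear:
  "evolve m j (\<lambda>p. c * f p + d * g p) p = c * evolve m j f p + d * evolve m j g p"
proof (induction j arbitrary: f g)
  case (Suc j)
  have "step_avg (m + j) (\<lambda>p. c * f p + d * g p) =
      (\<lambda>p. c * step_avg (m + j) f p + d * step_avg (m + j) g p)"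
    by (simp add: fun_eq_iff step_avg_linear)
  then show ?case using Suc.IH by simp
qed simp

lemma evolve_cmult: "evolve m j (\<lambda>p. c * f p) p = c * evolve m j f p"
  using evolve_linear[of m j c f 0 f] by simp

lemma evolve_const: "m \<ge> 1 \<Longrightarrow> evolve m j (\<lambda>p. c) p = c"
proof (induction j)
  case (Suc j)
  then have "step_avg (m + j) (\<lambda>p. c) = (\<lambda>p. c)"
    by (simp add: step_avg_def fun_eq_iff)
  then show ?case using Suc by simp
qed simp

section \<open>Law of the first parents\<close>

locale first_parent_tree = uniform_random_kdag +
  assumes k_pos: "k \<ge> 1"
begin

text \<open>The first parents chosen before time \<open>n\<close>; the value \<open>0\<close> elsewhere makes this a random
  variable with finitely many values.\<close>

definition hist :: "nat \<Rightarrow> 'a \<Rightarrow> nat \<Rightarrow> nat" where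
  "hist n \<omega> = (\<lambda>l. if 1 \<le> l \<and> l < n then par l 0 \<omega> else 0)"

lemma hist_Suc: "n \<ge> 1 \<Longrightarrow> hist (Suc n) \<omega> = (hist n \<omega>)(n := par n 0 \<omega>)"
  by (auto simp: hist_def fun_eq_iff)

lemma path_length_eq_depth:
  assumes \<omega>: "\<omega> \<in> space M"
  shows "l < n \<Longrightarrow> path_length par l \<omega> = depth (hist n \<omega>) l"
proof (induction l rule: less_induct)
  case (less l)
  show ?case
  proof (cases l)
    case (Suc l')
    have lt: "par l 0 \<omega> < l" using par_less[of l 0] \<omega> k_pos Suc by simp
    have "path_length par l \<omega> = Suc (path_length par (par l 0 \<omega>) \<omega>)"
      using path_length_step[OF k_pos \<omega>] Suc by simp
    also have "\<dots> = Suc (depth (hist n \<omega>) (par l 0 \<omega>))"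
      using less lt by simp
    also have "par l 0 \<omega> = min l' (hist n \<omega> (Suc l'))"
      using lt Suc less.prems by (simp add: hist_def)
    finally show ?thesis using Suc by simp
  qed simp
qed

definition histories :: "nat \<Rightarrow> (nat \<Rightarrow> nat) set" where
  "histories n = {q. \<forall>l. if 1 \<le> l \<and> l < n then q l < l else q l = 0}"

lemma finite_histories: "finite (histories n)"
proof (rule finite_subset)
  show "histories n \<subseteq> {f. \<forall>x. (x \<in> {..<n} \<longrightarrow> f x \<in> {..n}) \<and> (x \<notin> {..<n} \<longrightarrow> f x = 0)}"
  proof
    fix q assume q: "q \<in> histories n"
    have "(l \<in> {..<n} \<longrightarrow> q l \<in> {..n}) \<and> (l \<notin> {..<n} \<longrightarrow> q l = 0)" for l
      using q unfolding histories_def by (cases "l = 0") (auto dest!: spec[of _ l])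
    then show "q \<in> {f. \<forall>x. (x \<in> {..<n} \<longrightarrow> f x \<in> {..n}) \<and> (x \<notin> {..<n} \<longrightarrow> f x = 0)}"
      by blast
  qed
  show "finite {f :: nat \<Rightarrow> nat. \<forall>x. (x \<in> {..<n} \<longrightarrow> f x \<in> {..n}) \<and> (x \<notin> {..<n} \<longrightarrow> f x = 0)}"
    by (rule finite_set_of_finite_funs) auto
qed

lemma hist_in_histories: "\<omega> \<in> space M \<Longrightarrow> hist n \<omega> \<in> histories n"
  using par_less k_pos by (auto simp: histories_def hist_def)

lemma hist_eq_iff:
  "q \<in> histories n \<Longrightarrow> hist n \<omega> = q \<longleftrightarrow> (\<forall>l\<in>{1..<n}. par l 0 \<omega> = q l)"
  unfolding histories_def hist_def fun_eq_iff by (auto dest: spec split: if_splits)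

lemma par_event: "l \<ge> 1 \<Longrightarrow> {\<omega> \<in> space M. par l 0 \<omega> = u} \<in> events"
proof -
  assume l: "l \<ge> 1"
  have "{\<omega> \<in> space M. par l 0 \<omega> = u} = par l 0 -` ({u} \<inter> {..<l}) \<inter> space M"
    using par_less[of l 0] l k_pos by auto
  also have "\<dots> \<in> events"
    using par_measurable[of l 0] l k_pos by (intro measurable_sets[where A = "count_space {..<l}"]) auto
  finally show ?thesis .
qed

lemma prob_par: 
  assumes "l \<ge> 1" "u < l"
  shows "prob {\<omega> \<in> space M. par l 0 \<omega> = u} = 1 / real l"
proof -
  have "measure (distr M (count_space {..<l}) (par l 0)) {u} = prob (par l 0 -` {u} \<inter> space M)"
    using par_measurable[of l 0] assms k_pos by (intro measure_distr) auto
  then have "prob (par l 0 -` {u} \<inter> space M) = measure (uniform_count_measure {..<l}) {u}"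
    using distr_par[of l 0] assms k_pos by simp
  also have "\<dots> = 1 / real l"
    using assms by (subst measure_uniform_count_measure) auto
  also have "par l 0 -` {u} \<inter> space M = {\<omega> \<in> space M. par l 0 \<omega> = u}" by auto
  finally show ?thesis .
qed

text \<open>The joint law of the first parents.  The independence of the choices enters the
  development only here.\<close>

lemma prob_first_parents:
  assumes "\<And>l. l \<in> {1..<n} \<Longrightarrow> q l < l"
  shows "prob {\<omega> \<in> space M. \<forall>l\<in>{1..<n}. par l 0 \<omega> = q l} = (\<Prod>l\<in>{1..<n}. 1 / real l)"
proof (cases "n \<le> 1")
  case True
  then show ?thesis by (simp add: prob_space)
next
  case False
  let ?J = "{1..<n} \<times> {0::nat}"
  have "indep_vars (\<lambda>(m, i). count_space {..<m}) (\<lambda>(m, i). par m i) ?J"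
    using k_pos by (intro indep_vars_subset[OF indep_par]) auto
  then have "prob (\<Inter>x\<in>?J. (case x of (m, i) \<Rightarrow> par m i) -` {q (fst x)} \<inter> space M) =
      (\<Prod>x\<in>?J. prob ((case x of (m, i) \<Rightarrow> par m i) -` {q (fst x)} \<inter> space M))"
    using False assms by (intro indep_varsD_finite) auto
  also have "(\<Inter>x\<in>?J. (case x of (m, i) \<Rightarrow> par m i) -` {q (fst x)} \<inter> space M) =
      {\<omega> \<in> space M. \<forall>l\<in>{1..<n}. par l 0 \<omega> = q l}"
    using False by auto
  also have "(\<Prod>x\<in>?J. prob ((case x of (m, i) \<Rightarrow> par m i) -` {q (fst x)} \<inter> space M)) =
      (\<Prod>l\<in>{1..<n}. prob {\<omega> \<in> space M. par l 0 \<omega> = q l})"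
    by (rule prod.reindex_cong[of "\<lambda>l. (l, 0)"])
       (auto intro!: inj_onI arg_cong[where f = prob])
  also have "\<dots> = (\<Prod>l\<in>{1..<n}. 1 / real l)"
    using assms by (intro prod.cong prob_par) auto
  finally show ?thesis .
qed

lemma hist_event: "q \<in> histories n \<Longrightarrow> {\<omega> \<in> space M. hist n \<omega> = q} \<in> events"
proof -
  assume q: "q \<in> histories n"
  have "{\<omega> \<in> space M. \<forall>l\<in>{1..<n}. par l 0 \<omega> = q l} \<in> events"
    by (rule sets.sets_Collect_finite_All) (auto intro: par_event)
  then show ?thesis by (simp add: hist_eq_iff[OF q])
qed

text \<open>The new parent is uniform given the past, because both sides are products of the
  single-choice probabilities \<open>1 / l\<close>.\<close>

lemma prob_hist_Suc:
  assumes "n \<ge> 1" "q \<in> histories n" "u < n"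
  shows "prob {\<omega> \<in> space M. hist n \<omega> = q \<and> par n 0 \<omega> = u} = prob {\<omega> \<in> space M. hist n \<omega> = q} / real n"
proof -
  have ql: "q l < l" if "l \<in> {1..<n}" for l
    using assms(2) that by (auto simp: histories_def dest: spec[of _ l])
  have "{\<omega> \<in> space M. hist n \<omega> = q \<and> par n 0 \<omega> = u} =
      {\<omega> \<in> space M. \<forall>l\<in>{1..<Suc n}. par l 0 \<omega> = (q(n := u)) l}"
    using assms(1) by (auto simp: hist_eq_iff[OF assms(2)] less_Suc_eq)
  then have "prob {\<omega> \<in> space M. hist n \<omega> = q \<and> par n 0 \<omega> = u} = (\<Prod>l\<in>{1..<Suc n}. 1 / real l)"
    using ql assms by (simp only:, intro prob_first_parents) (auto simp: less_Suc_eq)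
  also have "\<dots> = (\<Prod>l\<in>{1..<n}. 1 / real l) / real n"
    using assms(1) by simp
  also have "(\<Prod>l\<in>{1..<n}. 1 / real l) = prob {\<omega> \<in> space M. hist n \<omega> = q}"
    using prob_first_parents[OF ql] by (simp add: hist_eq_iff[OF assms(2)])
  finally show ?thesis .
qed

lemma hist_expand:
  assumes "\<omega> \<in> space M"
  shows "(f (hist n \<omega>) :: real) =
    (\<Sum>q\<in>histories n. f q * indicator {\<omega> \<in> space M. hist n \<omega> = q} \<omega>)"
proof -
  have "(\<Sum>q\<in>histories n. f q * indicator {\<omega> \<in> space M. hist n \<omega> = q} \<omega>) =
      (\<Sum>q\<in>histories n. if q = hist n \<omega> then f q else 0)"
    using assms by (intro sum.cong) (auto simp: indicator_def)
  then show ?thesis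
    using assms by (simp add: hist_in_histories finite_histories)
qed

lemma integrable_hist [simp]: "integrable M (\<lambda>\<omega>. f (hist n \<omega>) :: real)"
proof -
  have "integrable M (\<lambda>\<omega>. \<Sum>q\<in>histories n. f q * indicator {\<omega> \<in> space M. hist n \<omega> = q} \<omega>)"
    using hist_event by (intro Bochner_Integration.integrable_sum integrable_mult_right
      integrable_real_indicator) (auto simp: emeasure_eq_measure)
  then show ?thesis
    by (rule Bochner_Integration.integrable_cong[THEN iffD1, rotated 2])
       (simp_all only: hist_expand[symmetric])
qed

lemma expectation_hist:
  "expectation (\<lambda>\<omega>. f (hist n \<omega>)) =
    (\<Sum>q\<in>histories n. f q * prob {\<omega> \<in> space M. hist n \<omega> = q})"
proof -
  have "expectation (\<lambda>\<omega>. f (hist n \<omega>)) =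
      expectation (\<lambda>\<omega>. \<Sum>q\<in>histories n. f q * indicator {\<omega> \<in> space M. hist n \<omega> = q} \<omega>)"
    by (intro Bochner_Integration.integral_cong refl hist_expand)
  also have "\<dots> = (\<Sum>q\<in>histories n. f q * prob {\<omega> \<in> space M. hist n \<omega> = q})"
    using hist_event by (subst Bochner_Integration.integral_sum)
      (auto intro!: integrable_mult_right integrable_real_indicator sum.cong
        simp: emeasure_eq_measure)
  finally show ?thesis .
qed

text \<open>Split according to the finitely many values of the history and of the new parent, and use
  \<open>prob_hist_Suc\<close>.\<close>

lemma expectation_step:
  assumes n: "n \<ge> 1"
  shows "expectation (\<lambda>\<omega>. f (hist (Suc n) \<omega>)) = expectation (\<lambda>\<omega>. step_avg n f (hist n \<omega>))"
proof -
  let ?A = "\<lambda>q u. {\<omega> \<in> space M. hist n \<omega> = q \<and> par n 0 \<omega> = u}"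
  have ev: "?A q u \<in> events" if "q \<in> histories n" for q u
  proof -
    have "?A q u = {\<omega> \<in> space M. hist n \<omega> = q} \<inter> {\<omega> \<in> space M. par n 0 \<omega> = u}" by auto
    then show ?thesis using hist_event[OF that] par_event[OF n] by simp
  qed
  have "f (hist (Suc n) \<omega>) = (\<Sum>q\<in>histories n. \<Sum>u<n. f (q(n := u)) * indicator (?A q u) \<omega>)"
    if "\<omega> \<in> space M" for \<omega>
  proof -
    have lt: "par n 0 \<omega> < n" using par_less[of n 0] that n k_pos by simp
    have "(\<Sum>q\<in>histories n. \<Sum>u<n. f (q(n := u)) * indicator (?A q u) \<omega>) =
        (\<Sum>q\<in>histories n. if q = hist n \<omega> then \<Sum>u<n. if u = par n 0 \<omega> then f (q(n := u)) else 0 else 0)"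
      using that by (intro sum.cong refl) (auto simp: indicator_def intro!: sum.cong)
    then show ?thesis
      using that lt n by (simp add: hist_in_histories finite_histories hist_Suc)
  qed
  then have "expectation (\<lambda>\<omega>. f (hist (Suc n) \<omega>)) =
      expectation (\<lambda>\<omega>. \<Sum>q\<in>histories n. \<Sum>u<n. f (q(n := u)) * indicator (?A q u) \<omega>)"
    by (intro Bochner_Integration.integral_cong refl) simp
  also have "\<dots> = (\<Sum>q\<in>histories n. expectation (\<lambda>\<omega>. \<Sum>u<n. f (q(n := u)) * indicator (?A q u) \<omega>))"
    using ev by (intro Bochner_Integration.integral_sum Bochner_Integration.integrable_sum
      integrable_mult_right integrable_real_indicator) (auto simp: emeasure_eq_measure)
  also have "\<dots> = (\<Sum>q\<in>histories n. \<Sum>u<n. f (q(n := u)) * prob (?A q u))"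
    using ev by (intro sum.cong refl, subst Bochner_Integration.integral_sum)
      (auto intro!: integrable_mult_right integrable_real_indicator sum.cong
        simp: emeasure_eq_measure)
  also have "\<dots> = (\<Sum>q\<in>histories n. step_avg n f q * prob {\<omega> \<in> space M. hist n \<omega> = q})"
    using n by (intro sum.cong refl)
      (simp add: prob_hist_Suc step_avg_def sum_distrib_right sum_divide_distrib)
  also have "\<dots> = expectation (\<lambda>\<omega>. step_avg n f (hist n \<omega>))"
    by (simp only: expectation_hist)
  finally show ?thesis .
qed

lemma expectation_evolve:
  "m \<ge> 1 \<Longrightarrow> expectation (\<lambda>\<omega>. f (hist (m + j) \<omega>)) = expectation (\<lambda>\<omega>. evolve m j f (hist m \<omega>))"
proof (induction j arbitrary: f)
  case (Suc j)
  have "expectation (\<lambda>\<omega>. f (hist (m + Suc j) \<omega>)) =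
      expectation (\<lambda>\<omega>. step_avg (m + j) f (hist (m + j) \<omega>))"
    using expectation_step[of "m + j" f] Suc.prems by simp
  also have "\<dots> = expectation (\<lambda>\<omega>. evolve m j (step_avg (m + j) f) (hist m \<omega>))"
    by (rule Suc.IH) (rule Suc.prems)
  finally show ?case by simp
qed simp

lemma markov_hist:
  assumes "\<And>\<omega>. \<omega> \<in> space M \<Longrightarrow> f (hist n \<omega>) \<ge> 0"
    and "\<And>\<omega>. \<omega> \<in> space M \<Longrightarrow> Q \<omega> \<Longrightarrow> f (hist n \<omega>) \<ge> 1"
  shows "prob {\<omega> \<in> space M. Q \<omega>} \<le> expectation (\<lambda>\<omega>. f (hist n \<omega>))"
proof (cases "{\<omega> \<in> space M. Q \<omega>} \<in> events")
  case True
  then have "prob {\<omega> \<in> space M. Q \<omega>} = expectation (indicator {\<omega> \<in> space M. Q \<omega>})"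
    by simp
  also have "\<dots> \<le> expectation (\<lambda>\<omega>. f (hist n \<omega>))"
    using True assms by (intro integral_mono integrable_real_indicator)
      (auto simp: emeasure_eq_measure indicator_def)
  finally show ?thesis .
next
  \<comment> \<open>A set outside the \<open>\<sigma>\<close>-algebra has measure \<open>0\<close> by convention.\<close>
  case False
  then show ?thesis
    using assms by (simp add: measure_notin_sets integral_nonneg_AE)
qed

section \<open>Generating function of the depth\<close>

text \<open>A new node below \<open>u\<close> adds \<open>z * z ^ depth u\<close>, which on average over \<open>u\<close> is \<open>z / n\<close> times
  the present total.\<close>

lemma expectation_weight:
  assumes "n \<ge> 1"
  shows "expectation (\<lambda>\<omega>. \<Sum>u<n. z ^ depth (hist n \<omega>) u) = (\<Prod>j\<in>{1..<n}. 1 + z / real j)"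
  using assms
proof (induction n rule: nat_induct_at_least)
  case base
  show ?case by (simp add: prob_space)
next
  case (Suc n)
  define S where "S = (\<lambda>n p. \<Sum>u<n. z ^ depth p u)"
  have step: "step_avg n (S (Suc n)) p = (1 + z / real n) * S n p" for p
  proof -
    have "step_avg n (S (Suc n)) p = (\<Sum>u<n. S n p + z * z ^ depth p u) / real n"
      unfolding step_avg_def S_def by simp
    also have "\<dots> = (real n * S n p + z * S n p) / real n"
      by (simp add: sum.distrib sum_distrib_left S_def)
    finally show ?thesis using Suc.hyps by (simp add: field_simps)
  qed
  have "expectation (\<lambda>\<omega>. S (Suc n) (hist (Suc n) \<omega>)) = (1 + z / real n) * expectation (\<lambda>\<omega>. S n (hist n \<omega>))"
    using Suc.hyps by (simp add: expectation_step step)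
  then show ?case using Suc by (simp add: S_def)
qed

lemma expectation_power_depth:
  assumes "n \<ge> 1"
  shows "expectation (\<lambda>\<omega>. z ^ depth (hist (Suc n) \<omega>) n) = z / real n * (\<Prod>j\<in>{1..<n}. 1 + z / real j)"
proof -
  have "step_avg n (\<lambda>p. z ^ depth p n) p = z / real n * (\<Sum>u<n. z ^ depth p u)" for p
    by (simp add: step_avg_def sum_distrib_left sum_divide_distrib)
  then show ?thesis
    using assms by (simp add: expectation_step[OF assms, of "\<lambda>p. z ^ depth p n"] expectation_weight)
qed

end

section \<open>Growth of products and logarithms\<close>

text \<open>Bernoulli's inequality for a real exponent is Young's inequality for \<open>1 + z * x\<close> and \<open>1\<close>
  with weights \<open>1 / z\<close> and \<open>1 - 1 / z\<close>.\<close>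

lemma Bernoulli_powr:
  fixes x z :: real
  assumes "x \<ge> 0" "z \<ge> 1"
  shows "1 + z * x \<le> (1 + x) powr z"
proof -
  have "(1 + z * x) powr (1 / z) * 1 powr (1 - 1 / z) \<le> 1 / z * (1 + z * x) + (1 - 1 / z) * 1"
    using assms by (intro Youngs_inequality_0) (auto simp: add_pos_nonneg)
  also have "\<dots> = 1 + x" using assms by (simp add: field_simps)
  finally have "((1 + z * x) powr (1 / z)) powr z \<le> (1 + x) powr z"
    using assms by (intro powr_mono2) auto
  then show ?thesis using assms by (simp add: powr_powr add_pos_nonneg)
qed

lemma ln_Suc_diff_ge: "1 / real (Suc j) \<le> ln (real (Suc j)) - ln (real j)" if "j \<ge> 1"
proof -
  have "ln (real j / real (Suc j)) \<le> real j / real (Suc j) - 1"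
    using that by (intro ln_le_minus_one) auto
  then show ?thesis using that by (simp add: ln_div field_simps)
qed

lemma ln_Suc_diff_le: "ln (real (Suc j)) - ln (real j) \<le> 1 / real j" if "j \<ge> 1"
proof -
  have "ln (real (Suc j) / real j) \<le> real (Suc j) / real j - 1"
    using that by (intro ln_le_minus_one) auto
  then show ?thesis using that by (simp add: ln_div field_simps)
qed

text \<open>No constant factor is lost here, as is required for the exact form of the tail bound; the
  price is the restriction to \<open>z \<ge> 1\<close>.\<close>

lemma weight_prod_le_powr:
  fixes z :: real
  assumes "n \<ge> 1" "z \<ge> 1"
  shows "(\<Prod>j\<in>{1..<n}. 1 + z / real j) \<le> real n powr z"
  using assms(1)
proof (induction n rule: nat_induct_at_least)
  case (Suc n)
  have "(\<Prod>j\<in>{1..<Suc n}. 1 + z / real j) = (\<Prod>j\<in>{1..<n}. 1 + z / real j) * (1 + z / real n)"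
    using Suc by simp
  also have "\<dots> \<le> real n powr z * (1 + 1 / real n) powr z"
    using Suc assms Bernoulli_powr[of "1 / real n" z]
    by (intro mult_mono) (auto intro!: prod_nonneg)
  also have "\<dots> = real (Suc n) powr z"
    using Suc by (simp add: powr_mult[symmetric] distrib_left add.commute)
  finally show ?case .
qed simp

text \<open>Lower deviations of the depth need \<open>z < 1\<close>, where the preceding bound fails.
  The factor \<open>1 + z\<close> is the term \<open>j = 1\<close>, and the other terms are compared with increments of \<open>ln\<close>.\<close>

lemma weight_prod_le_one_plus_powr:
  fixes z :: real
  assumes "n \<ge> 1" "z > 0"
  shows "(\<Prod>j\<in>{1..n}. 1 + z / real j) \<le> (1 + z) * real n powr z"
  using assms(1)
proof (induction n rule: nat_induct_at_least)
  case (Suc m)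
  have "1 + z / real (Suc m) \<le> exp (z * (1 / real (Suc m)))"
    using exp_ge_add_one_self[of "z * (1 / real (Suc m))"] by simp
  also have "\<dots> \<le> exp (z * (ln (real (Suc m)) - ln (real m)))"
    using ln_Suc_diff_ge[OF Suc.hyps] assms(2) by (simp only: exp_le_cancel_iff mult_left_mono)
  finally have "(\<Prod>j\<in>{1..m}. 1 + z / real j) * (1 + z / real (Suc m)) \<le>
      (1 + z) * real m powr z * exp (z * (ln (real (Suc m)) - ln (real m)))"
    using Suc assms(2) by (intro mult_mono) (auto simp: add_nonneg_nonneg)
  also have "\<dots> = (1 + z) * real (Suc m) powr z"
    using Suc.hyps by (simp add: powr_def exp_add[symmetric] algebra_simps)
  finally show ?case by simp
qed (use assms in simp)

text \<open>This is the exponent of Chernoff's bound at the optimal \<open>z = c\<close>.  It vanishes at \<open>c = 1\<close>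
  only, by strictness of \<open>ln x \<le> x - 1\<close>.\<close>

lemma chernoff_exponent_neg:
  fixes c :: real
  assumes "c > 0" "c \<noteq> 1"
  shows "c - 1 - c * ln c < 0"
proof -
  have "ln (1 / c) < 1 / c - 1"
    using assms ln_eq_minus_one[of "1 / c"] ln_le_minus_one[of "1 / c"]
    by (auto simp: less_le)
  then have "c * ln (1 / c) < c * (1 / c - 1)"
    using assms by (intro mult_strict_left_mono) auto
  then show ?thesis using assms by (simp add: ln_div algebra_simps)
qed

lemma exp_neg_ln_tendsto_0:
  fixes d K :: real
  assumes "d < 0"
  shows "(\<lambda>n. K * exp (d * ln (real n))) \<longlonglongrightarrow> 0"
proof -
  have "filterlim (\<lambda>n. - d * ln (real n)) at_top sequentially"
    using assms by (intro filterlim_tendsto_pos_mult_at_top[OF tendsto_const]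
      filterlim_compose[OF ln_at_top] filterlim_real_sequentially) auto
  then have "filterlim (\<lambda>n. d * ln (real n)) at_bot sequentially"
    by (simp add: filterlim_uminus_at_bot)
  then have "(\<lambda>n. exp (d * ln (real n))) \<longlonglongrightarrow> 0"
    by (rule filterlim_compose[OF exp_at_bot])
  then show ?thesis by (rule tendsto_mult_right_zero)
qed

context first_parent_tree begin

section \<open>Depth of a single node and upper bound for the height\<close>

lemma path_length_eq_depth': "\<omega> \<in> space M \<Longrightarrow> path_length par n \<omega> = depth (hist (Suc n) \<omega>) n"
  by (rule path_length_eq_depth) auto

text \<open>One bound for both tails: the sign of \<open>ln z\<close> decides whether \<open>Q\<close> may put the depth above
  \<open>y\<close> (for \<open>z > 1\<close>) or below it (for \<open>z < 1\<close>).\<close>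

lemma chernoff_path_length:
  fixes y z :: real
  assumes "n \<ge> 1" "z > 0"
    and Q: "\<And>\<omega>. \<omega> \<in> space M \<Longrightarrow> Q \<omega> \<Longrightarrow> (real (path_length par n \<omega>) - y) * ln z \<ge> 0"
  shows "prob {\<omega> \<in> space M. Q \<omega>} \<le>
    z powr (- y) * (z / real n * (\<Prod>j\<in>{1..<n}. 1 + z / real j))"
proof -
  have "prob {\<omega> \<in> space M. Q \<omega>} \<le>
      expectation (\<lambda>\<omega>. z powr (- y) * z ^ depth (hist (Suc n) \<omega>) n)"
  proof (rule markov_hist[where n = "Suc n"])
    fix \<omega> assume \<omega>: "\<omega> \<in> space M" "Q \<omega>"
    have "z powr (- y) * z ^ depth (hist (Suc n) \<omega>) n = 
        exp ((real (path_length par n \<omega>) - y) * ln z)"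
      using assms(2) \<omega>(1) by (simp add: path_length_eq_depth' powr_def powr_realpow[symmetric]
        exp_add[symmetric] algebra_simps)
    then show "z powr (- y) * z ^ depth (hist (Suc n) \<omega>) n \<ge> 1"
      using Q[OF \<omega>] by simp
  qed (use assms in auto)
  also have "\<dots> = z powr (- y) * (z / real n * (\<Prod>j\<in>{1..<n}. 1 + z / real j))"
    using expectation_power_depth[OF assms(1), of z] by simp
  finally show ?thesis .
qed

lemma path_length_tail:
  fixes t :: int
  assumes n: "n \<ge> 2" and t: "ln (real n) \<le> real_of_int t"
  shows "prob {\<omega> \<in> space M. int (path_length par n \<omega>) > t}
    \<le> exp (real_of_int t - ln (real n) - real_of_int t * ln (real_of_int t / ln (real n)))"
proof -
  define L where "L = ln (real n)"
  define z where "z = real_of_int t / L"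
  have L: "L > 0" using n by (simp add: L_def)
  have z: "z \<ge> 1" using t L by (simp add: z_def L_def)
  have "prob {\<omega> \<in> space M. int (path_length par n \<omega>) > t} \<le>
      z powr (- (real_of_int t + 1)) * (z / real n * (\<Prod>j\<in>{1..<n}. 1 + z / real j))"
    using n z by (intro chernoff_path_length) auto
  also have "\<dots> \<le> z powr (- (real_of_int t + 1)) * (z / real n * real n powr z)"
    using n z weight_prod_le_powr[of n z] by (intro mult_left_mono) auto
  also have "\<dots> = exp (real_of_int t - L - real_of_int t * ln z)"
  proof -
    have "z powr (- (real_of_int t + 1)) * (z / real n * real n powr z) =
        exp (- (real_of_int t + 1) * ln z) * (exp (ln z) * exp (- L) * exp (z * L))"
      using n z by (simp add: powr_def L_def exp_minus divide_inverse)
    also have "\<dots> = exp (z * L - L - real_of_int t * ln z)"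
      by (simp add: exp_add[symmetric] algebra_simps)
    finally show ?thesis using L by (simp add: z_def)
  qed
  finally show ?thesis by (simp add: z_def L_def)
qed

text \<open>Chernoff's bound with \<open>z = c\<close>, which is optimal at \<open>y = c * ln n\<close>.\<close>

lemma path_length_deviation:
  fixes c :: real
  assumes c: "c > 0" "c \<noteq> 1"
    and Q: "\<And>n \<omega>. n \<ge> 2 \<Longrightarrow> \<omega> \<in> space M \<Longrightarrow> Q n \<omega> \<Longrightarrow>
      (real (path_length par n \<omega>) - c * ln (real n)) * ln c \<ge> 0"
  shows "(\<lambda>n. prob {\<omega> \<in> space M. Q n \<omega>}) \<longlonglongrightarrow> 0"
proof (rule tendsto_sandwich[OF _ _ tendsto_const exp_neg_ln_tendsto_0[OF chernoff_exponent_neg[OF c]]])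
  show "\<forall>\<^sub>F n in sequentially. prob {\<omega> \<in> space M. Q n \<omega>} \<le>
      c * (1 + c) * exp ((c - 1 - c * ln c) * ln (real n))"
    using eventually_ge_at_top[of 2]
  proof eventually_elim
    case (elim n)
    have "prob {\<omega> \<in> space M. Q n \<omega>} \<le>
        c powr (- (c * ln (real n))) * (c / real n * (\<Prod>j\<in>{1..<n}. 1 + c / real j))"
      using elim c Q by (intro chernoff_path_length) auto
    also have "\<dots> \<le> c powr (- (c * ln (real n))) * (c / real n * ((1 + c) * real n powr c))"
    proof (intro mult_left_mono)
      have "(\<Prod>j\<in>{1..<n}. 1 + c / real j) \<le> (\<Prod>j\<in>{1..n}. 1 + c / real j)"
        using c by (intro prod_mono2) auto
      also have "\<dots> \<le> (1 + c) * real n powr c"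
        using elim c by (intro weight_prod_le_one_plus_powr) auto
      finally show "(\<Prod>j\<in>{1..<n}. 1 + c / real j) \<le> (1 + c) * real n powr c" .
    qed (use c in auto)
    also have "\<dots> = c * (1 + c) * (exp (- (c * ln (real n)) * ln c) * exp (- ln (real n)) * exp (c * ln (real n)))"
      using elim c by (simp add: powr_def exp_minus field_simps)
    also have "\<dots> = c * (1 + c) * exp ((c - 1 - c * ln c) * ln (real n))"
      by (simp add: exp_add[symmetric] algebra_simps)
    finally show ?case .
  qed
qed auto

text \<open>For a positive limit the lower tail has to be examined only at positive thresholds
  \<open>c - \<epsilon>\<close>.\<close>

lemma converges_in_probI:
  assumes "\<And>n. X n \<in> borel_measurable M"
    and "\<And>\<epsilon>. \<epsilon> > 0 \<Longrightarrow> (\<lambda>n. prob {\<omega> \<in> space M. X n \<omega> > c + \<epsilon>}) \<longlonglongrightarrow> 0"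
    and "\<And>\<epsilon>. \<epsilon> > 0 \<Longrightarrow> \<epsilon> < c \<Longrightarrow> (\<lambda>n. prob {\<omega> \<in> space M. X n \<omega> < c - \<epsilon>}) \<longlonglongrightarrow> 0"
    and c: "c > 0"
  shows "converges_in_prob M X c"
  unfolding converges_in_prob_def
proof (intro conjI allI impI)
  fix \<epsilon> :: real assume \<epsilon>: "\<epsilon> > 0"
  note [measurable] = assms(1)
  \<comment> \<open>Shrinking \<open>\<epsilon>\<close> keeps \<open>c - \<delta>\<close> positive and only enlarges the event.\<close>
  define \<delta> where "\<delta> = min \<epsilon> (c / 2)"
  have \<delta>: "\<delta> > 0" "\<delta> < c" "\<delta> \<le> \<epsilon>" using \<epsilon> c by (auto simp: \<delta>_def min_def)
  have "(\<lambda>n. prob {\<omega> \<in> space M. X n \<omega> > c + \<delta>} + prob {\<omega> \<in> space M. X n \<omega> < c - \<delta>}) \<longlonglongrightarrow> 0 + 0"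
    using \<delta> assms by (intro tendsto_add) auto
  then have lim: "(\<lambda>n. prob {\<omega> \<in> space M. X n \<omega> > c + \<delta>} + prob {\<omega> \<in> space M. X n \<omega> < c - \<delta>}) \<longlonglongrightarrow> 0"
    by simp
  show "(\<lambda>n. prob {\<omega> \<in> space M. \<bar>X n \<omega> - c\<bar> > \<epsilon>}) \<longlonglongrightarrow> 0"
  proof (rule tendsto_sandwich[OF _ _ tendsto_const lim])
    show "\<forall>\<^sub>F n in sequentially. prob {\<omega> \<in> space M. \<bar>X n \<omega> - c\<bar> > \<epsilon>} \<le>
        prob {\<omega> \<in> space M. X n \<omega> > c + \<delta>} + prob {\<omega> \<in> space M. X n \<omega> < c - \<delta>}"
    proof (rule always_eventually, rule allI)
      fix n
      have "prob {\<omega> \<in> space M. \<bar>X n \<omega> - c\<bar> > \<epsilon>} \<le>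
          prob ({\<omega> \<in> space M. X n \<omega> > c + \<delta>} \<union> {\<omega> \<in> space M. X n \<omega> < c - \<delta>})"
        using \<delta> by (intro finite_measure_mono) (auto simp: abs_if split: if_splits)
      also have "\<dots> \<le> prob {\<omega> \<in> space M. X n \<omega> > c + \<delta>} + prob {\<omega> \<in> space M. X n \<omega> < c - \<delta>}"
        by (intro measure_Un_le) auto
      finally show "prob {\<omega> \<in> space M. \<bar>X n \<omega> - c\<bar> > \<epsilon>} \<le>
        prob {\<omega> \<in> space M. X n \<omega> > c + \<delta>} + prob {\<omega> \<in> space M. X n \<omega> < c - \<delta>}" .
    qed
  qed auto
qed (rule assms)

lemma path_length_over_ln_converges:
  "converges_in_prob M (\<lambda>n \<omega>. real (path_length par n \<omega>) / ln (real n)) 1"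
proof (rule converges_in_probI)
  fix n
  note [measurable] = path_length_measurable[OF k_pos]
  show "(\<lambda>\<omega>. real (path_length par n \<omega>) / ln (real n)) \<in> borel_measurable M"
    by measurable
next
  fix \<epsilon> :: real assume "\<epsilon> > 0"
  then show "(\<lambda>n. prob {\<omega> \<in> space M. 1 + \<epsilon> < real (path_length par n \<omega>) / ln (real n)}) \<longlonglongrightarrow> 0"
    by (intro path_length_deviation[of "1 + \<epsilon>"] mult_nonneg_nonneg)
       (auto simp: field_simps)
next
  fix \<epsilon> :: real assume "\<epsilon> > 0" "\<epsilon> < 1"
  then show "(\<lambda>n. prob {\<omega> \<in> space M. real (path_length par n \<omega>) / ln (real n) < 1 - \<epsilon>}) \<longlonglongrightarrow> 0"
    by (intro path_length_deviation[of "1 - \<epsilon>"] mult_nonpos_nonpos)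
       (auto simp: field_simps)
qed simp

text \<open>A union bound over all nodes that is carried out inside the expectation: one node of depth
  above \<open>c * ln n\<close> already contributes \<open>exp (c * ln n)\<close> to the total weight at \<open>z = exp 1\<close>, whose
  mean has the order \<open>exp (exp 1 * ln n)\<close>.\<close>

lemma max_path_length_upper:
  fixes c :: real
  assumes c: "c > exp 1"
  shows "(\<lambda>n. prob {\<omega> \<in> space M. \<exists>l\<in>{1..n}. real (path_length par l \<omega>) > c * ln (real n)}) \<longlonglongrightarrow> 0"
proof (rule tendsto_sandwich[OF _ _ tendsto_const exp_neg_ln_tendsto_0])
  show "exp 1 - c < 0" using c by simp
  show "\<forall>\<^sub>F n in sequentially. prob {\<omega> \<in> space M. \<exists>l\<in>{1..n}. real (path_length par l \<omega>) > c * ln (real n)}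
     \<le> (1 + exp 1) * exp ((exp 1 - c) * ln (real n))"
    using eventually_ge_at_top[of 1]
  proof eventually_elim
    case (elim n)
    define L where "L = ln (real n)"
    have "prob {\<omega> \<in> space M. \<exists>l\<in>{1..n}. real (path_length par l \<omega>) > c * L} \<le>
      expectation (\<lambda>\<omega>. exp (- c * L) * (\<Sum>u<Suc n. exp 1 ^ depth (hist (Suc n) \<omega>) u))"
    proof (rule markov_hist[where n = "Suc n"])
      fix \<omega> assume \<omega>: "\<omega> \<in> space M" and "\<exists>l\<in>{1..n}. real (path_length par l \<omega>) > c * L"
      then obtain l where l: "l < Suc n" "real (path_length par l \<omega>) > c * L"
        by (auto simp flip: less_Suc_eq_le)
      have "1 \<le> exp (- c * L + real (path_length par l \<omega>))" using l by simp
      also have "\<dots> = exp (- c * L) * exp 1 ^ depth (hist (Suc n) \<omega>) l"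
        unfolding exp_add using path_length_eq_depth[OF \<omega> l(1)] by (simp add: exp_of_nat_mult[symmetric])
      also have "\<dots> \<le> exp (- c * L) * (\<Sum>u<Suc n. exp 1 ^ depth (hist (Suc n) \<omega>) u)"
        using l by (intro mult_left_mono member_le_sum) auto
      finally show "1 \<le> exp (- c * L) * (\<Sum>u<Suc n. exp 1 ^ depth (hist (Suc n) \<omega>) u)" .
    qed (intro mult_nonneg_nonneg sum_nonneg; simp)
    also have "\<dots> = exp (- c * L) * (\<Prod>j\<in>{1..n}. 1 + exp 1 / real j)"
      using expectation_weight[of "Suc n" "exp 1"] by (simp add: atLeastLessThanSuc_atLeastAtMost)
    also have "\<dots> \<le> exp (- c * L) * ((1 + exp 1) * real n powr exp 1)"
      using elim by (intro mult_left_mono weight_prod_le_one_plus_powr) auto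
    also have "\<dots> = (1 + exp 1) * (exp (- c * L) * exp (exp 1 * L))"
      using elim by (simp add: powr_def L_def)
    also have "\<dots> = (1 + exp 1) * exp ((exp 1 - c) * L)"
      by (simp add: exp_add[symmetric] algebra_simps)
    finally show ?case by (simp add: L_def)
  qed
qed auto

end

section \<open>Shallow nodes\<close>

definition root_children :: "nat \<Rightarrow> (nat \<Rightarrow> nat) \<Rightarrow> nat set" where
  "root_children n p = {v. v < n \<and> depth p v = 1}"

lemma root_children_Suc:
  "u < n \<Longrightarrow> root_children (Suc n) (p(n := u)) =
    (if u = 0 then insert n (root_children n p) else root_children n p)"
  by (cases u) (auto simp: root_children_def less_Suc_eq)

lemma finite_root_children [simp]: "finite (root_children n p)"
  by (simp add: root_children_def)

text \<open>A node of depth above \<open>2\<close> was not attached to the root or to a child of the root.  At every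
  step up to time \<open>N\<close>, avoiding the children of the root alone has conditional probability at most
  \<open>1 - X / N \<le> exp (- X / N)\<close>, where \<open>X\<close> is the number of those born before \<open>m\<close>.\<close>

lemma evolve_no_shallow:
  assumes m: "m \<ge> 1" and j: "m + j \<le> Suc N"
  shows "evolve m j (\<lambda>q. of_bool (\<forall>v\<in>{m..<m + j}. depth q v > 2)) p
    \<le> exp (- real (card (root_children m p)) / real N) ^ j"
  using j
proof (induction j)
  case (Suc j)
  define n where "n = m + j"
  define E where "E = exp (- real (card (root_children m p)) / real N)"
  have n: "n \<ge> 1" "n \<le> N" "m \<le> n" using Suc.prems m by (auto simp: n_def)
  have "evolve m (Suc j) (\<lambda>q. of_bool (\<forall>v\<in>{m..<m + Suc j}. depth q v > 2)) p =
      evolve m j (step_avg n (\<lambda>q. of_bool (\<forall>v\<in>{m..<Suc n}. depth q v > 2))) p"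
    by (simp add: n_def)
  also have "\<dots> \<le> evolve m j (\<lambda>q. E * of_bool (\<forall>v\<in>{m..<m + j}. depth q v > 2)) p"
  proof (rule evolve_mono)
    fix q assume q: "\<And>l. l < m \<Longrightarrow> q l = p l"
    have eq: "root_children m q = root_children m p"
    proof -
      have "depth q v = depth p v" if "v < m" for v
        using q that by (intro depth_cong) auto
      then show ?thesis by (auto simp: root_children_def)
    qed
    have "step_avg n (\<lambda>q. of_bool (\<forall>v\<in>{m..<Suc n}. depth q v > 2)) q =
        (\<Sum>u<n. of_bool (\<forall>v\<in>{m..<n}. depth q v > 2) * of_bool (depth q u > 1)) / real n"
      unfolding step_avg_def using n
      by (intro arg_cong[where f = "\<lambda>x. x / real n"] sum.cong)
         (auto simp: atLeastLessThanSuc)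
    also have "\<dots> = of_bool (\<forall>v\<in>{m..<n}. depth q v > 2) * (real (card {u. u < n \<and> depth q u > 1}) / real n)"
      by (simp add: sum_distrib_left[symmetric] Int_def)
    also have "\<dots> \<le> of_bool (\<forall>v\<in>{m..<n}. depth q v > 2) * E"
    proof (rule mult_left_mono)
      have "card {u. u < n \<and> depth q u > 1} + card (root_children m p) =
          card ({u. u < n \<and> depth q u > 1} \<union> root_children m p)"
        by (rule card_Un_disjoint[symmetric]) (auto simp add: eq[symmetric], auto simp: root_children_def)
      also have "\<dots> \<le> card {..<n}"
        using n by (intro card_mono) (auto simp: root_children_def)
      finally have "real (card {u. u < n \<and> depth q u > 1}) \<le> real n - real (card (root_children m p))"
        by simp
      then have "real (card {u. u < n \<and> depth q u > 1}) / real n \<le> 1 + (- real (card (root_children m p)) / real n)"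
        using n by (simp add: field_simps)
      also have "\<dots> \<le> exp (- real (card (root_children m p)) / real n)"
        by (rule exp_ge_add_one_self)
      also have "\<dots> \<le> E"
        unfolding E_def using n by (simp add: frac_le)
      finally show "real (card {u. u < n \<and> depth q u > 1}) / real n \<le> E" .
    qed simp
    finally show "step_avg n (\<lambda>q. of_bool (\<forall>v\<in>{m..<Suc n}. depth q v > 2)) q \<le>
        E * of_bool (\<forall>v\<in>{m..<m + j}. depth q v > 2)"
      by (simp add: n_def mult.commute)
  qed
  also have "\<dots> = E * evolve m j (\<lambda>q. of_bool (\<forall>v\<in>{m..<m + j}. depth q v > 2)) p"
    by (rule evolve_cmult)
  also have "\<dots> \<le> E * E ^ j"
    using Suc by (intro mult_left_mono) (auto simp: E_def)
  finally show ?case by (simp add: E_def)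
qed simp

context first_parent_tree begin

text \<open>Node \<open>n\<close> is a child of the root with probability \<open>1 / n\<close>, so the mean gains the factor
  \<open>1 - (1 - z) / n\<close> at each step.\<close>

lemma expectation_root_children:
  fixes z :: real
  assumes n: "n \<ge> 1" and z: "0 \<le> z" "z \<le> 1"
  shows "expectation (\<lambda>\<omega>. z ^ card (root_children n (hist n \<omega>))) \<le> real n powr - (1 - z)"
  using n
proof (induction n rule: nat_induct_at_least)
  case base
  have "root_children 1 p = {}" for p by (auto simp: root_children_def)
  then show ?case by (simp add: prob_space)
next
  case (Suc n)
  have step: "step_avg n (\<lambda>p. z ^ card (root_children (Suc n) p)) p =
      (1 - (1 - z) / real n) * z ^ card (root_children n p)" for p
  proof -
    have "(\<Sum>u<n. z ^ card (root_children (Suc n) (p(n := u)))) =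
        (\<Sum>u<n. z ^ card (root_children n p) * (if u = 0 then z else 1))"
    proof (intro sum.cong refl)
      fix u assume "u \<in> {..<n}"
      then show "z ^ card (root_children (Suc n) (p(n := u))) =
          z ^ card (root_children n p) * (if u = 0 then z else 1)"
        by (simp add: root_children_Suc) (simp add: root_children_def)
    qed
    also have "\<dots> = z ^ card (root_children n p) * (\<Sum>u<n. 1 - (if u = 0 then 1 - z else 0))"
      unfolding sum_distrib_left by (intro sum.cong) auto
    also have "(\<Sum>u<n. 1 - (if u = 0 then 1 - z else 0)) = real n - (1 - z)"
      using Suc.hyps by (simp add: sum_subtractf)
    finally have eq: "(\<Sum>u<n. z ^ card (root_children (Suc n) (p(n := u)))) =
        z ^ card (root_children n p) * (real n - (1 - z))" .
    show ?thesis unfolding step_avg_def eq using Suc.hyps by (simp add: field_simps)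
  qed
  have "1 - (1 - z) / real n \<le> exp (- ((1 - z) * (1 / real n)))"
    using exp_ge_add_one_self[of "- ((1 - z) * (1 / real n))"] by simp
  also have "\<dots> \<le> exp (- ((1 - z) * (ln (real (Suc n)) - ln (real n))))"
    unfolding exp_le_cancel_iff neg_le_iff_le
    using ln_Suc_diff_le[OF Suc.hyps] z by (intro mult_left_mono) auto
  finally have le: "1 - (1 - z) / real n \<le> exp (- ((1 - z) * (ln (real (Suc n)) - ln (real n))))" .
  have "expectation (\<lambda>\<omega>. z ^ card (root_children (Suc n) (hist (Suc n) \<omega>))) =
      (1 - (1 - z) / real n) * expectation (\<lambda>\<omega>. z ^ card (root_children n (hist n \<omega>)))"
    using Suc.hyps
    by (simp add: expectation_step[where f = "\<lambda>p. z ^ card (root_children (Suc n) p)"] step)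
  also have "\<dots> \<le> exp (- ((1 - z) * (ln (real (Suc n)) - ln (real n)))) * real n powr - (1 - z)"
    using le Suc z by (intro mult_mono integral_nonneg_AE) auto
  also have "\<dots> = real (Suc n) powr - (1 - z)"
    using Suc.hyps by (simp add: powr_def exp_add[symmetric] algebra_simps)
  finally show ?case .
qed

text \<open>Condition on the tree before the middle time \<open>m\<close>: at least \<open>n / 2\<close> steps remain, so the
  conditional probability is at most \<open>z ^ X\<close> with \<open>z = exp (- 1 / 2)\<close>.\<close>

lemma prob_no_shallow:
  assumes n: "n \<ge> 1" and m: "m = (n + 1) div 2"
  shows "prob {\<omega> \<in> space M. \<forall>l\<in>{m..n}. path_length par l \<omega> > 2}
    \<le> real m powr - (1 - exp (- 1 / 2))"
proof -
  define j where "j = n + 1 - m"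
  have m1: "m \<ge> 1" and mj: "m + j = Suc n" and jn: "real j \<ge> real n / 2"
    using n m by (auto simp: j_def)
  let ?f = "\<lambda>q. of_bool (\<forall>v\<in>{m..<m + j}. depth q v > 2) :: real"
  have "prob {\<omega> \<in> space M. \<forall>l\<in>{m..n}. path_length par l \<omega> > 2} \<le> expectation (\<lambda>\<omega>. ?f (hist (m + j) \<omega>))"
  proof (rule markov_hist)
    fix \<omega> assume \<omega>: "\<omega> \<in> space M" and shallow: "\<forall>l\<in>{m..n}. path_length par l \<omega> > 2"
    have "depth (hist (m + j) \<omega>) v > 2" if "v \<in> {m..<m + j}" for v
    proof -
      have "v \<in> {m..n}" using that mj by auto
      then show ?thesis using shallow that path_length_eq_depth[OF \<omega>, of v "m + j"] by fastforce
    qed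
    then show "?f (hist (m + j) \<omega>) \<ge> 1" by simp
  qed simp
  also have "\<dots> = expectation (\<lambda>\<omega>. evolve m j ?f (hist m \<omega>))"
    by (rule expectation_evolve) (rule m1)
  also have "\<dots> \<le> expectation (\<lambda>\<omega>. exp (- 1 / 2) ^ card (root_children m (hist m \<omega>)))"
  proof (rule integral_mono)
    fix \<omega>
    let ?c = "real (card (root_children m (hist m \<omega>)))"
    have "evolve m j ?f (hist m \<omega>) \<le> exp (- ?c / real n) ^ j"
      using m1 mj by (intro evolve_no_shallow) auto
    also have "\<dots> = exp (- (?c * (real j / real n)))"
      by (simp add: exp_of_nat_mult[symmetric])
    also have "\<dots> \<le> exp (- (?c * (1 / 2)))"
      using jn n by (simp only: exp_le_cancel_iff neg_le_iff_le, intro mult_left_mono)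
        (auto simp: field_simps)
    also have "\<dots> = exp (- 1 / 2) ^ card (root_children m (hist m \<omega>))"
      by (simp add: exp_of_nat_mult[symmetric])
    finally show "evolve m j ?f (hist m \<omega>) \<le> exp (- 1 / 2) ^ card (root_children m (hist m \<omega>))" .
  qed (rule integrable_hist)+
  also have "\<dots> \<le> real m powr - (1 - exp (- 1 / 2))"
    using m1 by (intro expectation_root_children) auto
  finally show ?thesis .
qed

lemma min_path_length_le_2:
  "(\<lambda>n. prob {\<omega> \<in> space M.
      (MIN l\<in>{l. real n / 2 \<le> real l \<and> l \<le> n}. path_length par l \<omega>) \<le> 2}) \<longlonglongrightarrow> 1"
proof -
  have half: "{l. real n / 2 \<le> real l \<and> l \<le> n} = {(n + 1) div 2..n}" for n :: nat
    by (auto simp: field_simps)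
  note [measurable] = path_length_measurable[OF k_pos]
  let ?z = "exp (- 1 / 2) :: real"
  have "filterlim (\<lambda>n::nat. (n + 1) div 2) at_top sequentially"
    unfolding filterlim_at_top
  proof
    fix Z :: nat
    show "\<forall>\<^sub>F n in sequentially. Z \<le> (n + 1) div 2"
      using eventually_ge_at_top[of "2 * Z"] by eventually_elim auto
  qed
  then have "filterlim (\<lambda>n::nat. real ((n + 1) div 2)) at_top sequentially"
    by (rule filterlim_compose[OF filterlim_real_sequentially])
  then have "(\<lambda>n::nat. real ((n + 1) div 2) powr - (1 - ?z)) \<longlonglongrightarrow> 0"
    by (intro tendsto_neg_powr) auto
  from tendsto_diff[OF tendsto_const this]
  have lim: "(\<lambda>n::nat. 1 - real ((n + 1) div 2) powr - (1 - ?z)) \<longlonglongrightarrow> 1"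
    by simp
  show ?thesis unfolding half
  proof (rule tendsto_sandwich[OF _ _ lim tendsto_const])
    show "\<forall>\<^sub>F n in sequentially. 1 - real ((n + 1) div 2) powr - (1 - ?z) \<le>
        prob {\<omega> \<in> space M. (MIN l\<in>{(n + 1) div 2..n}. path_length par l \<omega>) \<le> 2}"
      using eventually_ge_at_top[of 1]
    proof eventually_elim
      case (elim n)
      define I where "I = {(n + 1) div 2..n}"
      have I: "finite I" "I \<noteq> {}" using elim by (auto simp: I_def)
      have "{\<omega> \<in> space M. (MIN l\<in>I. path_length par l \<omega>) \<le> 2} =
          space M - {\<omega> \<in> space M. \<forall>l\<in>I. path_length par l \<omega> > 2}"
        using I by (auto simp: Min_le_iff not_less)
      moreover have "{\<omega> \<in> space M. \<forall>l\<in>I. path_length par l \<omega> > 2} \<in> events"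
        using I(1) by (intro sets.sets_Collect_finite_All) measurable
      ultimately have "prob {\<omega> \<in> space M. (MIN l\<in>I. path_length par l \<omega>) \<le> 2} =
          1 - prob {\<omega> \<in> space M. \<forall>l\<in>I. path_length par l \<omega> > 2}"
        by (simp add: prob_compl)
      then show ?case
        using prob_no_shallow[OF elim refl] by (simp add: I_def)
    qed
  qed auto
qed

end

section \<open>Generations descending from a set of nodes\<close>

text \<open>\<open>generation A m p j\<close> consists of the nodes whose \<open>j\<close>-th ancestor lies in \<open>A\<close> and whose
  path to it stays at nodes from \<open>m\<close> on.  Recursion on \<open>j\<close> avoids recursion along the parents; the
  minimum plays the same role as in \<open>depth\<close>.\<close>

primrec generation :: "nat set \<Rightarrow> nat \<Rightarrow> (nat \<Rightarrow> nat) \<Rightarrow> nat \<Rightarrow> nat set" where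
  "generation A m p 0 = A"
| "generation A m p (Suc j) = {v. m \<le> v \<and> min (v - 1) (p v) \<in> generation A m p j}"

definition gen_size :: "nat set \<Rightarrow> nat \<Rightarrow> nat \<Rightarrow> nat \<Rightarrow> (nat \<Rightarrow> nat) \<Rightarrow> real" where
  "gen_size A m j n p = real (card (generation A m p j \<inter> {..<n}))"

lemma generation_update_old:
  "v < n \<Longrightarrow> v \<in> generation A m (p(n := u)) j \<longleftrightarrow> v \<in> generation A m p j"
  by (induction j arbitrary: v) auto

lemma generation_update_new:
  "u < n \<Longrightarrow> m \<le> n \<Longrightarrow> n \<in> generation A m (p(n := u)) (Suc j) \<longleftrightarrow> u \<in> generation A m p j"
  by (cases n) (simp_all add: min_absorb2 generation_update_old)

lemma gen_size_update:
  assumes "u < n" "m \<le> n"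
  shows "gen_size A m (Suc j) (Suc n) (p(n := u)) =
    gen_size A m (Suc j) n p + of_bool (u \<in> generation A m p j)"
proof -
  have "generation A m (p(n := u)) (Suc j) \<inter> {..<Suc n} =
      (generation A m p (Suc j) \<inter> {..<n}) \<union> (if u \<in> generation A m p j then {n} else {})"
    using assms generation_update_old[of _ n A m p u "Suc j"]
      generation_update_new[OF assms, of A p j]
    by (auto simp: less_Suc_eq simp del: generation.simps)
  then show ?thesis by (simp add: gen_size_def del: generation.simps)
qed

lemma gen_size_0: "A \<subseteq> {..<m} \<Longrightarrow> m \<le> n \<Longrightarrow> gen_size A m 0 n p = real (card A)"
  by (auto simp: gen_size_def intro!: arg_cong[where f = card])

lemma gen_size_start:
  assumes "A \<subseteq> {..<m}"
  shows "gen_size A m j m p = of_bool (j = 0) * real (card A)"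
proof (cases j)
  case 0
  then show ?thesis using gen_size_0[OF assms] by simp
next
  case (Suc j')
  have "{v. m \<le> v \<and> min (v - Suc 0) (p v) \<in> generation A m p j'} \<inter> {..<m} = {}" by auto
  then show ?thesis using Suc by (simp add: gen_size_def)
qed

lemma depth_generation:
  assumes m: "m \<ge> 1" and A: "\<And>v. v \<in> A \<Longrightarrow> depth p v \<ge> r"
  shows "v \<in> generation A m p j \<Longrightarrow> depth p v \<ge> r + j"
proof (induction j arbitrary: v)
  case 0
  then show ?case using A by simp
next
  case (Suc j)
  then obtain w where "v = Suc w" using m by (cases v) auto
  then show ?case using Suc.IH[of "min w (p v)"] Suc.prems by simp
qed

text \<open>The expected size of the \<open>j\<close>-th generation at time \<open>m + i\<close>, per starting node.  It is the
  elementary symmetric polynomial of degree \<open>j\<close> in the reciprocals of \<open>m, ..., m + i - 1\<close>.\<close>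

primrec mean_gen :: "nat \<Rightarrow> nat \<Rightarrow> nat \<Rightarrow> real" where
  "mean_gen m 0 j = of_bool (j = 0)"
| "mean_gen m (Suc i) j =
    mean_gen m i j + (case j of 0 \<Rightarrow> 0 | Suc j' \<Rightarrow> mean_gen m i j' / real (m + i))"

lemma mean_gen_0 [simp]: "mean_gen m i 0 = 1"
  by (induction i) auto

text \<open>The sum over the generations up to \<open>k\<close> is taken because the fluctuation of generation
  \<open>j + 1\<close> is driven by that of generation \<open>j\<close>: the sum satisfies a closed recursive inequality,
  whereas the individual variances do not.\<close>

definition gen_deviation :: "nat set \<Rightarrow> nat \<Rightarrow> nat \<Rightarrow> nat \<Rightarrow> (nat \<Rightarrow> nat) \<Rightarrow> real" where
  "gen_deviation A m k i p =
    (\<Sum>j\<le>k. (gen_size A m j (m + i) p - mean_gen m i j * real (card A))\<^sup>2)"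

lemma sum_generation_indicator:
  "(\<Sum>u<n. of_bool (u \<in> generation A m p j)) = gen_size A m j n p"
  by (simp add: gen_size_def Int_commute)

text \<open>Every node of a generation below \<open>k\<close> produces a node of the next one with probability
  \<open>1 / n\<close>, and the starting set does not grow.\<close>

lemma step_avg_total_gen_size:
  assumes "m \<ge> 1" "A \<subseteq> {..<m}"
  shows "step_avg (m + i) (\<lambda>q. \<Sum>j\<le>k. gen_size A m j (m + Suc i) q) p \<le>
    (1 + 1 / real (m + i)) * (\<Sum>j\<le>k. gen_size A m j (m + i) p)"
proof -
  let ?n = "m + i"
  have "step_avg ?n (\<lambda>q. \<Sum>j\<le>k. gen_size A m j (Suc ?n) q) p =
      (\<Sum>j\<le>k. step_avg ?n (\<lambda>q. gen_size A m j (Suc ?n) q) p)"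
    unfolding step_avg_def by (subst sum.swap) (simp add: sum_divide_distrib)
  also have "\<dots> \<le> (\<Sum>j\<le>k. gen_size A m j ?n p + (case j of 0 \<Rightarrow> 0 | Suc j' \<Rightarrow> gen_size A m j' ?n p / real ?n))"
  proof (rule sum_mono)
    fix j
    show "step_avg ?n (\<lambda>q. gen_size A m j (Suc ?n) q) p \<le>
        gen_size A m j ?n p + (case j of 0 \<Rightarrow> 0 | Suc j' \<Rightarrow> gen_size A m j' ?n p / real ?n)"
    proof (cases j)
      case 0
      then show ?thesis using assms by (simp add: step_avg_def gen_size_0)
    next
      case (Suc j')
      have "(\<Sum>u<?n. gen_size A m j (Suc ?n) (p(?n := u))) =
          (\<Sum>u<?n. gen_size A m j ?n p + of_bool (u \<in> generation A m p j'))"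
        unfolding Suc by (intro sum.cong gen_size_update) auto
      also have "\<dots> = real ?n * gen_size A m j ?n p + gen_size A m j' ?n p"
        by (simp only: sum.distrib sum_generation_indicator) simp
      finally show ?thesis
        using assms Suc by (simp add: step_avg_def add_divide_distrib)
    qed
  qed
  also have "\<dots> = (\<Sum>j\<le>k. gen_size A m j ?n p) + (\<Sum>j\<le>k. case j of 0 \<Rightarrow> 0 | Suc j' \<Rightarrow> gen_size A m j' ?n p / real ?n)"
    by (rule sum.distrib)
  also have "(\<Sum>j\<le>k. case j of 0 \<Rightarrow> 0 | Suc j' \<Rightarrow> gen_size A m j' ?n p / real ?n) =
      (\<Sum>j<k. gen_size A m j ?n p / real ?n)"
    by (simp add: sum.atMost_shift)
  also have "\<dots> \<le> (\<Sum>j\<le>k. gen_size A m j ?n p / real ?n)"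
    by (intro sum_mono2) (auto simp: gen_size_def)
  also have "\<dots> = 1 / real ?n * (\<Sum>j\<le>k. gen_size A m j ?n p)"
    by (simp add: sum_divide_distrib)
  finally show ?thesis by (simp add: algebra_simps)
qed

text \<open>The effect of one step on a squared deviation \<open>x\<close> that changes by a centred indicator:
  \<open>w\<close> is the deviation of the previous generation, of size \<open>y\<close> and mean \<open>\<nu>\<close>.  The mixed term
  \<open>2 * x * w / n\<close> is split into squares, so that no covariances between generations have to be followed.\<close>

lemma average_square_bernoulli:
  fixes x \<nu> y w :: real
  assumes n: "n \<ge> 1" and y: "y = (\<Sum>u<n. of_bool (P u))" and w: "w = y - \<nu>"
  shows "(\<Sum>u<n. (x + (of_bool (P u) - \<nu> / real n))\<^sup>2) / real n \<le>
    x\<^sup>2 + (x\<^sup>2 + w\<^sup>2) / real n + w\<^sup>2 / (real n)\<^sup>2 + y / real n"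
proof -
  define b where "b = (\<lambda>u. of_bool (P u) :: real)"
  define \<mu> where "\<mu> = \<nu> / real n"
  have b2: "(b u)\<^sup>2 = b u" for u by (simp add: b_def)
  have "(\<Sum>u<n. (x + (b u - \<mu>))\<^sup>2) = (\<Sum>u<n. (x - \<mu>)\<^sup>2 + (2 * (x - \<mu>) + 1) * b u)"
  proof (intro sum.cong refl)
    fix u
    have "(x + (b u - \<mu>))\<^sup>2 = (x - \<mu>)\<^sup>2 + 2 * (x - \<mu>) * b u + (b u)\<^sup>2"
      by (simp add: power2_eq_square algebra_simps)
    then show "(x + (b u - \<mu>))\<^sup>2 = (x - \<mu>)\<^sup>2 + (2 * (x - \<mu>) + 1) * b u"
      by (simp add: b2 distrib_right)
  qed
  also have "\<dots> = real n * (x - \<mu>)\<^sup>2 + (2 * (x - \<mu>) + 1) * y"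
    by (simp add: sum.distrib sum_distrib_left[symmetric] y b_def)
  finally have "(\<Sum>u<n. (x + (b u - \<mu>))\<^sup>2) / real n =
      (x - \<mu>)\<^sup>2 + (2 * (x - \<mu>) + 1) * (y / real n)"
    using n by (simp add: field_simps)
  also have "\<dots> = x\<^sup>2 + 2 * x * (y / real n - \<mu>) + (y / real n - \<mu>)\<^sup>2 - (y / real n)\<^sup>2 + y / real n"
    by (simp add: power2_eq_square algebra_simps)
  also have "y / real n - \<mu> = w / real n"
    by (simp add: w \<mu>_def diff_divide_distrib)
  also have "2 * x * (w / real n) \<le> (x\<^sup>2 + w\<^sup>2) / real n"
    using sum_squares_bound[of x w] n by (simp add: field_simps)
  finally show ?thesis
    by (simp add: b_def \<mu>_def power_divide) (smt (verit) zero_le_power2 divide_nonneg_nonneg)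
qed

text \<open>Each squared deviation occurs at most once on its own, twice with weight \<open>1 / n\<close> and once
  with weight \<open>1 / n\<^sup>2\<close>, which together form the factor \<open>(1 + 1 / n)\<^sup>2\<close>; the total size is the newly
  created variance.\<close>

lemma step_avg_gen_deviation:
  assumes "m \<ge> 1" "A \<subseteq> {..<m}"
  shows "step_avg (m + i) (gen_deviation A m k (Suc i)) p \<le>
    (1 + 1 / real (m + i))\<^sup>2 * gen_deviation A m k i p +
    1 / real (m + i) * (\<Sum>j\<le>k. gen_size A m j (m + i) p)"
proof -
  let ?n = "m + i" and ?a = "real (card A)"
  define dev where "dev = (\<lambda>j. gen_size A m j ?n p - mean_gen m i j * ?a)"
  have Q: "gen_deviation A m k i p = (\<Sum>j\<le>k. (dev j)\<^sup>2)"
    by (simp add: gen_deviation_def dev_def)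
  have "step_avg ?n (gen_deviation A m k (Suc i)) p =
      (\<Sum>j\<le>k. step_avg ?n (\<lambda>q. (gen_size A m j (Suc ?n) q - mean_gen m (Suc i) j * ?a)\<^sup>2) p)"
    unfolding step_avg_def gen_deviation_def by (subst sum.swap) (simp add: sum_divide_distrib)
  also have "\<dots> \<le> (\<Sum>j\<le>k. case j of 0 \<Rightarrow> 0 | Suc j' \<Rightarrow>
      (dev (Suc j'))\<^sup>2 + ((dev (Suc j'))\<^sup>2 + (dev j')\<^sup>2) / real ?n + (dev j')\<^sup>2 / (real ?n)\<^sup>2
        + gen_size A m j' ?n p / real ?n)"
  proof (rule sum_mono)
    fix j
    show "step_avg ?n (\<lambda>q. (gen_size A m j (Suc ?n) q - mean_gen m (Suc i) j * ?a)\<^sup>2) p \<le>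
      (case j of 0 \<Rightarrow> 0 | Suc j' \<Rightarrow>
      (dev (Suc j'))\<^sup>2 + ((dev (Suc j'))\<^sup>2 + (dev j')\<^sup>2) / real ?n + (dev j')\<^sup>2 / (real ?n)\<^sup>2
        + gen_size A m j' ?n p / real ?n)"
    proof (cases j)
      case 0
      then show ?thesis using assms by (simp add: step_avg_def gen_size_0 del: mean_gen.simps)
    next
      case (Suc j')
      have "step_avg ?n (\<lambda>q. (gen_size A m j (Suc ?n) q - mean_gen m (Suc i) j * ?a)\<^sup>2) p =
          (\<Sum>u<?n. (dev j + (of_bool (u \<in> generation A m p j') - mean_gen m i j' * ?a / real ?n))\<^sup>2) / real ?n"
        unfolding step_avg_def Suc dev_def
        by (intro arg_cong[where f = "\<lambda>x. x / real ?n"] sum.cong refl arg_cong[where f = "\<lambda>x. x\<^sup>2"],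
            subst gen_size_update) (auto simp: algebra_simps)
      also have "\<dots> \<le> (dev j)\<^sup>2 + ((dev j)\<^sup>2 + (dev j')\<^sup>2) / real ?n + (dev j')\<^sup>2 / (real ?n)\<^sup>2
          + gen_size A m j' ?n p / real ?n"
        using assms by (intro average_square_bernoulli)
          (auto simp only: sum_generation_indicator dev_def)
      finally show ?thesis by (simp add: Suc)
    qed
  qed
  also have "\<dots> = (\<Sum>j<k. (dev (Suc j))\<^sup>2) + ((\<Sum>j<k. (dev (Suc j))\<^sup>2) + (\<Sum>j<k. (dev j)\<^sup>2)) / real ?n
      + (\<Sum>j<k. (dev j)\<^sup>2) / (real ?n)\<^sup>2 + (\<Sum>j<k. gen_size A m j ?n p) / real ?n"
    by (simp add: sum.atMost_shift sum.distrib sum_divide_distrib add_divide_distrib)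
  also have "\<dots> \<le> (\<Sum>j\<le>k. (dev j)\<^sup>2) + ((\<Sum>j\<le>k. (dev j)\<^sup>2) + (\<Sum>j\<le>k. (dev j)\<^sup>2)) / real ?n
      + (\<Sum>j\<le>k. (dev j)\<^sup>2) / (real ?n)\<^sup>2 + (\<Sum>j\<le>k. gen_size A m j ?n p) / real ?n"
  proof -
    have 1: "(\<Sum>j<k. (dev (Suc j))\<^sup>2) \<le> (\<Sum>j\<le>k. (dev j)\<^sup>2)"
      by (simp add: sum.atMost_shift)
    have 2: "(\<Sum>j<k. (dev j)\<^sup>2) \<le> (\<Sum>j\<le>k. (dev j)\<^sup>2)"
      by (intro sum_mono2) auto
    have 3: "(\<Sum>j<k. gen_size A m j ?n p) \<le> (\<Sum>j\<le>k. gen_size A m j ?n p)"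
      by (intro sum_mono2) (auto simp: gen_size_def)
    show ?thesis
      using 1 2 3 by (intro add_mono divide_right_mono) auto
  qed
  also have "\<dots> = (1 + 1 / real ?n)\<^sup>2 * gen_deviation A m k i p + 1 / real ?n * (\<Sum>j\<le>k. gen_size A m j ?n p)"
    unfolding Q by (simp add: power2_eq_square algebra_simps add_divide_distrib)
  finally show ?thesis by simp
qed

lemma evolve_total_gen_size:
  assumes "m \<ge> 1" "A \<subseteq> {..<m}"
  shows "evolve m i (\<lambda>q. \<Sum>j\<le>k. gen_size A m j (m + i) q) p \<le> real (card A) * real (m + i) / real m"
proof (induction i)
  case 0
  show ?case using assms by (simp add: gen_size_start[OF assms(2)])
next
  case (Suc i)
  have "evolve m (Suc i) (\<lambda>q. \<Sum>j\<le>k. gen_size A m j (m + Suc i) q) p \<le>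
      evolve m i (\<lambda>q. (1 + 1 / real (m + i)) * (\<Sum>j\<le>k. gen_size A m j (m + i) q)) p"
    unfolding evolve.simps by (intro evolve_mono step_avg_total_gen_size assms)
  also have "\<dots> = (1 + 1 / real (m + i)) * evolve m i (\<lambda>q. \<Sum>j\<le>k. gen_size A m j (m + i) q) p"
    by (rule evolve_cmult)
  also have "\<dots> \<le> (1 + 1 / real (m + i)) * (real (card A) * real (m + i) / real m)"
    by (intro mult_left_mono Suc.IH) auto
  also have "\<dots> = ((1 + 1 / real (m + i)) * real (m + i)) * real (card A) / real m"
    by (simp only: times_divide_eq_right mult_ac)
  also have "(1 + 1 / real (m + i)) * real (m + i) = real (m + Suc i)"
    using assms by (simp add: field_simps)
  finally show ?case by (simp only: mult_ac)
qed

text \<open>After division by \<open>n\<^sup>2\<close> the recursion becomes additive with increments of order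
  \<open>1 / n\<^sup>2\<close>, whose sum is dominated by the telescoping difference of reciprocals.  The bound is linear in
  the number of starting nodes, which makes Chebyshev's inequality effective.\<close>

lemma evolve_gen_deviation:
  assumes "m \<ge> 1" "A \<subseteq> {..<m}"
  shows "evolve m i (gen_deviation A m k i) p \<le>
    real (card A) / real m * (real (m + i))\<^sup>2 * (1 / real m - 1 / real (m + i))"
proof (induction i)
  case 0
  have "gen_deviation A m k 0 p = 0"
    by (simp add: gen_deviation_def gen_size_start[OF assms(2)])
  then show ?case by simp
next
  case (Suc i)
  let ?n = "real (m + i)" and ?a = "real (card A)"
  have n: "?n > 0" "real m > 0" using assms by auto
  have "evolve m (Suc i) (gen_deviation A m k (Suc i)) p \<le>
      evolve m i (\<lambda>q. (1 + 1 / ?n)\<^sup>2 * gen_deviation A m k i q +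
        1 / ?n * (\<Sum>j\<le>k. gen_size A m j (m + i) q)) p"
    unfolding evolve.simps by (intro evolve_mono step_avg_gen_deviation assms)
  also have "\<dots> = (1 + 1 / ?n)\<^sup>2 * evolve m i (gen_deviation A m k i) p +
      1 / ?n * evolve m i (\<lambda>q. \<Sum>j\<le>k. gen_size A m j (m + i) q) p"
    by (rule evolve_linear)
  also have "\<dots> \<le> (1 + 1 / ?n)\<^sup>2 * (?a / real m * ?n\<^sup>2 * (1 / real m - 1 / ?n)) +
      1 / ?n * (?a * ?n / real m)"
    by (intro add_mono mult_left_mono Suc.IH evolve_total_gen_size assms) auto
  also have "\<dots> = ?a / real m * ((?n + 1)\<^sup>2 * (1 / real m - 1 / ?n) + 1)"
  proof -
    have alg: "s * (c * q * d) = c * ((s * q) * d)" for s c q d :: real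
      by (simp only: mult_ac)
    have "(1 + 1 / ?n) * ?n = ?n + 1" using n by (simp add: field_simps)
    then have "(1 + 1 / ?n)\<^sup>2 * ?n\<^sup>2 = (?n + 1)\<^sup>2"
      by (simp only: power_mult_distrib[symmetric])
    then have "(1 + 1 / ?n)\<^sup>2 * (?a / real m * ?n\<^sup>2 * (1 / real m - 1 / ?n)) =
        ?a / real m * ((?n + 1)\<^sup>2 * (1 / real m - 1 / ?n))"
      using alg[of "(1 + 1 / ?n)\<^sup>2" "?a / real m" "?n\<^sup>2" "1 / real m - 1 / ?n"] by (simp only:)
    moreover have "1 / ?n * (?a * ?n / real m) = ?a / real m"
      using n by (simp del: of_nat_add)
    ultimately show ?thesis by (simp only: distrib_left mult_1_right)
  qed
  also have "\<dots> \<le> ?a / real m * ((?n + 1)\<^sup>2 * (1 / real m - 1 / (?n + 1)))"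
  proof (rule mult_left_mono)
    have "(N + 1)\<^sup>2 * (1 / N - 1 / (N + 1)) = 1 + 1 / N" if "N > 0" for N :: real
    proof -
      have "(N + 1) * (1 / N - 1 / (N + 1)) = 1 / N"
        using that by (simp add: right_diff_distrib add_divide_distrib)
      then have "(N + 1)\<^sup>2 * (1 / N - 1 / (N + 1)) = (N + 1) * (1 / N)"
        by (simp only: power2_eq_square mult.assoc)
      then show ?thesis using that by (simp add: add_divide_distrib)
    qed
    from this[OF n(1)] have "(?n + 1)\<^sup>2 * (1 / ?n - 1 / (?n + 1)) \<ge> 1" using n by simp
    then show "(?n + 1)\<^sup>2 * (1 / real m - 1 / ?n) + 1 \<le> (?n + 1)\<^sup>2 * (1 / real m - 1 / (?n + 1))"
      by (simp add: algebra_simps)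
  qed simp
  also have "?n + 1 = real (m + Suc i)" by simp
  finally show ?case by (simp only: mult.assoc)
qed

lemma power_Suc_diff_le:
  fixes x y :: real
  assumes "0 \<le> y" "y \<le> x"
  shows "x ^ Suc j \<le> y ^ Suc j + real (Suc j) * (x - y) * x ^ j"
proof (induction j)
  case (Suc j)
  have "x ^ Suc (Suc j) \<le> x * (y ^ Suc j + real (Suc j) * (x - y) * x ^ j)"
    using mult_left_mono[OF Suc.IH, of x] assms by simp
  also have "\<dots> = y ^ Suc (Suc j) + (x - y) * y ^ Suc j + real (Suc j) * (x - y) * x ^ Suc j"
    by (simp add: algebra_simps)
  also have "(x - y) * y ^ Suc j \<le> (x - y) * x ^ Suc j"
    using assms by (intro mult_left_mono power_mono) auto
  finally show ?case by (simp add: algebra_simps)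
qed simp

text \<open>The elementary symmetric polynomial is compared with the integral it approximates,
  \<open>x ^ j / j!\<close> with \<open>x = ln ((m + i) / m)\<close>.  Since \<open>j\<close> distinct times are used, \<open>x\<close> has to be reduced;
  the shift by \<open>j / m\<close> absorbs the discretisation error of each of the \<open>j\<close> summations, because one
  increment of \<open>ln\<close> is at most \<open>1 / m\<close>.\<close>

lemma mean_gen_ge:
  assumes m: "m \<ge> 1"
  shows "mean_gen m i j \<ge> (max 0 (ln (real (m + i)) - ln (real m) - real j / real m)) ^ j / fact j"
proof (induction i arbitrary: j)
  case 0
  show ?case by (cases j) auto
next
  case (Suc i)
  show ?case
  proof (cases j)
    case (Suc j')
    let ?n = "m + i"
    \<comment> \<open>\<open>x\<close> and \<open>y\<close> belong to generation \<open>j\<close> at the new and the old time, \<open>w\<close> to generation \<open>j - 1\<close>;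
       \<open>x \<le> w\<close> is where the extra shift by \<open>1 / m\<close> is used.\<close>
    define x where "x = max 0 (ln (real (Suc ?n)) - ln (real m) - real (Suc j') / real m)"
    define y where "y = max 0 (ln (real ?n) - ln (real m) - real (Suc j') / real m)"
    define w where "w = max 0 (ln (real ?n) - ln (real m) - real j' / real m)"
    have inc: "ln (real (Suc ?n)) - ln (real ?n) \<le> 1 / real ?n"
      using m by (intro ln_Suc_diff_le) auto
    have mono: "ln (real ?n) \<le> ln (real (Suc ?n))" using m by simp
    have nm: "1 / real ?n \<le> 1 / real m" using m by (simp add: frac_le)
    have y: "0 \<le> y" "y \<le> x" using mono by (auto simp: x_def y_def)
    have xy: "x - y \<le> 1 / real ?n" using inc mono by (auto simp: x_def y_def max_def)
    have xw: "x \<le> w" using inc nm m by (simp add: x_def w_def add_divide_distrib max_def)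
    have "x ^ Suc j' \<le> y ^ Suc j' + real (Suc j') * (x - y) * x ^ j'"
      using y by (rule power_Suc_diff_le)
    also have "real (Suc j') * (x - y) * x ^ j' \<le> real (Suc j') * (1 / real ?n) * w ^ j'"
      using y xy xw by (intro mult_mono power_mono) auto
    finally have "x ^ Suc j' / fact (Suc j') \<le>
        (y ^ Suc j' + real (Suc j') * (1 / real ?n) * w ^ j') / fact (Suc j')"
      by (intro divide_right_mono add_left_mono) (auto simp del: fact_Suc)
    also have "\<dots> = y ^ Suc j' / fact (Suc j') + w ^ j' / fact j' / real ?n"
      unfolding fact_Suc add_divide_distrib by (simp del: of_nat_Suc of_nat_add)
    also have "\<dots> \<le> mean_gen m i (Suc j') + mean_gen m i j' / real ?n"
      using Suc.IH[of "Suc j'"] Suc.IH[of j'] unfolding y_def w_def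
      by (intro add_mono divide_right_mono) auto
    finally show ?thesis by (simp add: Suc x_def)
  qed (simp del: mean_gen.simps)
qed

section \<open>One block of growth\<close>

definition deep_count :: "nat \<Rightarrow> nat \<Rightarrow> (nat \<Rightarrow> nat) \<Rightarrow> nat" where
  "deep_count r n p = card {v. v < n \<and> depth p v \<ge> r}"

text \<open>Chebyshev's inequality for the \<open>k\<close>-th generation descending from the nodes of depth at
  least \<open>r\<close>; the members of that generation have depth at least \<open>r + k\<close>.\<close>

lemma evolve_deep_count:
  assumes m: "m \<ge> 1" and \<delta>: "\<delta> > 0" and mean: "mean_gen m i k \<ge> \<theta> + \<delta>"
    and a: "deep_count r m p > 0"
  shows "evolve m i (\<lambda>q. of_bool (real (deep_count (r + k) (m + i) q) < \<theta> * real (deep_count r m p))) p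
    \<le> (real (m + i) / real m)\<^sup>2 / (\<delta>\<^sup>2 * real (deep_count r m p))"
proof -
  define A where "A = {v. v < m \<and> depth p v \<ge> r}"
  define a where "a = real (card A)"
  have A: "A \<subseteq> {..<m}" by (auto simp: A_def)
  have apos: "a > 0" and aeq: "real (deep_count r m p) = a"
    using a by (auto simp: a_def A_def deep_count_def)
  have "evolve m i (\<lambda>q. of_bool (real (deep_count (r + k) (m + i) q) < \<theta> * a)) p \<le>
      evolve m i (\<lambda>q. 1 / (\<delta> * a)\<^sup>2 * gen_deviation A m k i q) p"
  proof (rule evolve_mono)
    fix q assume q: "\<And>l. l < m \<Longrightarrow> q l = p l"
    have dev: "(gen_size A m k (m + i) q - mean_gen m i k * a)\<^sup>2 \<le> gen_deviation A m k i q"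
      unfolding gen_deviation_def a_def by (rule member_le_sum) auto
    have dep: "depth q v \<ge> r" if "v \<in> A" for v
    proof -
      have "depth q v = depth p v" using that q by (intro depth_cong) (auto simp: A_def)
      then show ?thesis using that by (simp add: A_def)
    qed
    have "gen_size A m k (m + i) q \<le> real (deep_count (r + k) (m + i) q)"
      unfolding gen_size_def deep_count_def of_nat_le_iff
      using depth_generation[OF m dep] by (intro card_mono) auto
    moreover have "(\<theta> + \<delta>) * a \<le> mean_gen m i k * a"
      using mean apos by (intro mult_right_mono) auto
    ultimately have "\<delta> * a \<le> mean_gen m i k * a - gen_size A m k (m + i) q"
      if "real (deep_count (r + k) (m + i) q) < \<theta> * a"
      using that by (simp add: algebra_simps)
    then have "(\<delta> * a)\<^sup>2 \<le> (mean_gen m i k * a - gen_size A m k (m + i) q)\<^sup>2"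
      if "real (deep_count (r + k) (m + i) q) < \<theta> * a"
      using that \<delta> apos by (intro power_mono) auto
    then have "(\<delta> * a)\<^sup>2 \<le> gen_deviation A m k i q"
      if "real (deep_count (r + k) (m + i) q) < \<theta> * a"
      using that dev by (simp add: power2_commute)
    moreover have "gen_deviation A m k i q \<ge> 0" by (simp add: gen_deviation_def sum_nonneg)
    ultimately show "of_bool (real (deep_count (r + k) (m + i) q) < \<theta> * a) \<le>
        1 / (\<delta> * a)\<^sup>2 * gen_deviation A m k i q"
      using \<delta> apos by (auto simp: field_simps)
  qed
  also have "\<dots> = 1 / (\<delta> * a)\<^sup>2 * evolve m i (gen_deviation A m k i) p"
    by (rule evolve_cmult)
  also have "\<dots> \<le> 1 / (\<delta> * a)\<^sup>2 * (a / real m * (real (m + i))\<^sup>2 * (1 / real m - 1 / real (m + i)))"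
    unfolding a_def by (intro mult_left_mono evolve_gen_deviation m A) auto
  also have "\<dots> \<le> 1 / (\<delta> * a)\<^sup>2 * (a / real m * (real (m + i))\<^sup>2 * (1 / real m))"
    using apos by (intro mult_left_mono) auto
  also have "\<dots> = (real (m + i) / real m)\<^sup>2 / (\<delta>\<^sup>2 * a)"
    using apos \<delta> m by (simp add: power2_eq_square field_simps)
  finally show ?thesis by (simp add: aeq)
qed

section \<open>Choice of the block length\<close>

text \<open>The part of Stirling's formula that matters here, \<open>k! < (k / c) ^ k\<close>, by the ratio test:
  from \<open>k\<close> to \<open>k + 1\<close> the quotient of the two sides changes by a factor that tends to \<open>c / e\<close>.\<close>

lemma eventually_fact_less:
  fixes c :: real
  assumes c: "0 < c" "c < exp 1"
  shows "\<forall>\<^sub>F k in sequentially. fact k * c ^ k < real k ^ k"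
proof -
  define f where "f = (\<lambda>k::nat. fact k * c ^ k / real k ^ k :: real)"
  obtain q where q: "c / exp 1 < q" "q < 1"
    using dense[of "c / exp 1" 1] c by auto
  have "(\<lambda>k. c / (1 + 1 / real k) ^ k) \<longlonglongrightarrow> c / exp 1"
    by (intro tendsto_divide tendsto_const tendsto_exp_limit_sequentially) auto
  then have "\<forall>\<^sub>F k in sequentially. c / (1 + 1 / real k) ^ k < q"
    using q by (intro order_tendstoD(2))
  then obtain N where N: "\<And>k. k \<ge> N \<Longrightarrow> c / (1 + 1 / real k) ^ k < q"
    unfolding eventually_sequentially by blast
  have ratio: "f (Suc k) = c / (1 + 1 / real k) ^ k * f k" if "k \<ge> 1" for k
  proof -
    have "(1 + 1 / real k) ^ k * real k ^ k = real (Suc k) ^ k"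
      unfolding power_mult_distrib[symmetric] using that by (simp add: distrib_right add.commute)
    then have "c / (1 + 1 / real k) ^ k * f k = c * (fact k * c ^ k) / real (Suc k) ^ k"
      by (simp add: f_def del: of_nat_Suc)
    also have "\<dots> = f (Suc k)"
      unfolding f_def fact_Suc power_Suc by (simp del: of_nat_Suc)
    finally show ?thesis ..
  qed
  have "summable f"
  proof (rule summable_ratio_test[of q "max 1 N"])
    fix k assume k: "max 1 N \<le> k"
    have "norm (f (Suc k)) = c / (1 + 1 / real k) ^ k * norm (f k)"
      using k c by (subst ratio) (auto simp: abs_mult)
    also have "\<dots> \<le> q * norm (f k)"
      using N[of k] k by (intro mult_right_mono) auto
    finally show "norm (f (Suc k)) \<le> q * norm (f k)" .
  qed (rule q)
  then have "f \<longlonglongrightarrow> 0" by (rule summable_LIMSEQ_zero)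
  then have "\<forall>\<^sub>F k in sequentially. f k < 1" by (rule order_tendstoD(2)) simp
  then show ?thesis
    using eventually_ge_at_top[of 1] by eventually_elim (simp add: f_def)
qed

text \<open>Choose \<open>b\<close> as the integer part of \<open>exp (k / c)\<close> for large \<open>k\<close>.  Then \<open>k / d \<le> ln b \<le> k / c\<close>
  for a prescribed \<open>d\<close> between \<open>c\<close> and \<open>e\<close>, and \<open>(k / d) ^ k\<close> exceeds \<open>k!\<close>.\<close>

lemma block_exists:
  fixes c :: real
  assumes c: "0 < c" "c < exp 1"
  obtains b k :: nat where "b \<ge> 2" "c * ln (real b) \<le> real k" "ln (real b) ^ k / fact k > 1"
proof -
  obtain d where d: "c < d" "d < exp 1" using dense[OF c(2)] by blast
  define \<eta> where "\<eta> = 1 / c - 1 / d"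
  have \<eta>: "\<eta> > 0" using c d by (simp add: \<eta>_def frac_less2)
  have "\<forall>\<^sub>F k in sequentially. fact k * d ^ k < real k ^ k"
    using c d by (intro eventually_fact_less) auto
  moreover have "\<forall>\<^sub>F k in sequentially. real k \<ge> 1 / \<eta>"
    using filterlim_real_sequentially by (simp add: filterlim_at_top)
  moreover have "\<forall>\<^sub>F k in sequentially. k \<ge> (1::nat)" by (rule eventually_ge_at_top)
  ultimately have "\<forall>\<^sub>F k in sequentially. fact k * d ^ k < real k ^ k \<and> real k \<ge> 1 / \<eta> \<and> k \<ge> 1"
    by eventually_elim simp
  then obtain k where k: "fact k * d ^ k < real k ^ k" "real k \<ge> 1 / \<eta>" "k \<ge> 1"
    unfolding eventually_sequentially by blast
  define b where "b = nat \<lfloor>exp (real k / c)\<rfloor>"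
  have b_real: "real b = of_int \<lfloor>exp (real k / c)\<rfloor>" by (simp add: b_def)
  have upper: "real b \<le> exp (real k / c)" unfolding b_real by linarith
  have "exp (real k / d) * 2 \<le> exp (real k / d) * exp (real k * \<eta>)"
  proof (rule mult_left_mono)
    have "1 \<le> real k * \<eta>" using k(2) \<eta> by (simp add: field_simps)
    then show "2 \<le> exp (real k * \<eta>)" using exp_ge_add_one_self[of "real k * \<eta>"] by linarith
  qed simp
  also have "\<dots> = exp (real k / c)"
    unfolding exp_add[symmetric] by (simp add: \<eta>_def right_diff_distrib)
  finally have "exp (real k / d) + exp (real k / d) \<le> exp (real k / c)" by simp
  moreover have "exp (real k / d) > 1" using k c d by simp
  ultimately have lower: "exp (real k / d) \<le> real b" unfolding b_real by linarith
  have b1: "real b > 1" using lower \<open>exp (real k / d) > 1\<close> by linarith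
  have "ln (real b) \<le> real k / c"
    using upper b1 by (subst ln_exp[symmetric], subst ln_le_cancel_iff) auto
  then have "c * ln (real b) \<le> real k" using c by (simp add: field_simps)
  moreover have "b \<ge> 2" using b1 by simp
  moreover have "ln (real b) ^ k / fact k > 1"
  proof -
    have "real k / d \<le> ln (real b)"
      using lower b1 by (subst ln_exp[symmetric], subst ln_le_cancel_iff) auto
    then have "(real k / d) ^ k \<le> ln (real b) ^ k"
      using c d by (intro power_mono) auto
    moreover have "fact k < (real k / d) ^ k"
      using k(1) c d by (simp add: power_divide field_simps)
    ultimately show ?thesis by simp
  qed
  ultimately show ?thesis using that by blast
qed

text \<open>As \<open>m\<close> grows, the lower bound for the mean over the block \<open>{m..<b * m}\<close> tends to
  \<open>(ln b) ^ k / k!\<close>.  The excess over \<open>1\<close> is shared between the growth factor \<open>\<theta>\<close> and the margin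
  \<open>\<delta>\<close> left for Chebyshev's inequality.\<close>

lemma mean_gen_block:
  assumes b: "b \<ge> 1" and growth: "ln (real b) ^ k / fact k > 1"
  obtains \<theta> \<delta> m\<^sub>0 where "\<theta> > 1" "\<delta> > 0" "\<And>m. m \<ge> m\<^sub>0 \<Longrightarrow> mean_gen m ((b - 1) * m) k \<ge> \<theta> + \<delta>"
proof -
  define V where "V = ln (real b) ^ k / fact k"
  define \<delta> where "\<delta> = (V - 1) / 4"
  have V: "V > 1" using growth by (simp add: V_def)
  have "(\<lambda>m. real k / real m) \<longlonglongrightarrow> 0" by (rule lim_const_over_n)
  then have "(\<lambda>m. (max 0 (ln (real b) - real k / real m)) ^ k / fact k) \<longlonglongrightarrow>
      (max 0 (ln (real b) - 0)) ^ k / fact k"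
    by (intro tendsto_intros) auto
  moreover have "max 0 (ln (real b) - 0) = ln (real b)" using b by simp
  ultimately have "(\<lambda>m. (max 0 (ln (real b) - real k / real m)) ^ k / fact k) \<longlonglongrightarrow> V"
    by (simp add: V_def)
  moreover have "1 + \<delta> + \<delta> < V" using V by (simp add: \<delta>_def field_simps)
  ultimately have "\<forall>\<^sub>F m in sequentially. 1 + \<delta> + \<delta> < (max 0 (ln (real b) - real k / real m)) ^ k / fact k"
    by (rule order_tendstoD(1))
  then obtain m\<^sub>1 where m\<^sub>1: "\<And>m. m \<ge> m\<^sub>1 \<Longrightarrow>
      1 + \<delta> + \<delta> < (max 0 (ln (real b) - real k / real m)) ^ k / fact k"
    unfolding eventually_sequentially by blast
  have "mean_gen m ((b - 1) * m) k \<ge> (1 + \<delta>) + \<delta>" if m: "m \<ge> max 1 m\<^sub>1" for m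
  proof -
    have "m + (b - 1) * m = b * m" using b by (cases b) auto
    then have "ln (real (m + (b - 1) * m)) - ln (real m) = ln (real b)"
      using b m by (simp add: ln_mult)
    then show ?thesis
      using mean_gen_ge[of m "(b - 1) * m" k] m\<^sub>1[of m] m by simp
  qed
  then show ?thesis
    using that[of "1 + \<delta>" \<delta> "max 1 m\<^sub>1"] V by (simp add: \<delta>_def)
qed

section \<open>Height\<close>

context first_parent_tree begin

text \<open>The summand \<open>l\<close> bounds the probability that block \<open>l\<close> is the first in which the count of
  deep nodes fails to grow by the factor \<open>\<theta>\<close>.  Since all \<open>m\<^sub>0\<close> initial nodes have depth at least \<open>0\<close>,
  nothing can fail at the start.\<close>

lemma deep_count_growth:
  assumes b: "b \<ge> 1" and \<theta>: "\<theta> > 1" and \<delta>: "\<delta> > 0" and m\<^sub>0: "m\<^sub>0 \<ge> 1"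
    and mean: "\<And>m. m \<ge> m\<^sub>0 \<Longrightarrow> mean_gen m ((b - 1) * m) k' \<ge> \<theta> + \<delta>"
  shows "expectation (\<lambda>\<omega>. of_bool (real (deep_count (k' * i) (m\<^sub>0 * b ^ i) (hist (m\<^sub>0 * b ^ i) \<omega>)) < real m\<^sub>0 * \<theta> ^ i))
    \<le> (\<Sum>l<i. (real b)\<^sup>2 / (\<delta>\<^sup>2 * (real m\<^sub>0 * \<theta> ^ l)))"
proof (induction i)
  case 0
  have "deep_count 0 n p = n" for n p by (simp add: deep_count_def)
  then show ?case by simp
next
  case (Suc i)
  define m where "m = m\<^sub>0 * b ^ i"
  define x where "x = real m\<^sub>0 * \<theta> ^ i"
  define j where "j = (b - 1) * m"
  define f where "f = (\<lambda>q. of_bool (real (deep_count (k' * i + k') (m + j) q) < \<theta> * x) :: real)"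
  have m: "m \<ge> 1" "m \<ge> m\<^sub>0" using m\<^sub>0 b by (auto simp: m_def)
  have x: "x > 0" using m\<^sub>0 \<theta> by (simp add: x_def)
  have mj: "m + j = b * m" using b unfolding j_def by (cases b) auto
  have "evolve m j f p \<le> of_bool (real (deep_count (k' * i) m p) < x) + (real b)\<^sup>2 / (\<delta>\<^sup>2 * x)" for p
  proof (cases "real (deep_count (k' * i) m p) < x")
    case True
    have "evolve m j f p \<le> evolve m j (\<lambda>q. 1) p"
      by (rule evolve_mono) (simp add: f_def)
    also have "\<dots> = 1" using m(1) by (rule evolve_const)
    finally show ?thesis using True x \<delta> by (simp add: add_increasing2)
  next
    case False
    let ?a = "real (deep_count (k' * i) m p)"
    have "evolve m j f p \<le> evolve m j (\<lambda>q. of_bool (real (deep_count (k' * i + k') (m + j) q) < \<theta> * ?a)) p"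
    proof (rule evolve_mono)
      fix q
      have "\<theta> * x \<le> \<theta> * ?a" using False \<theta> by (intro mult_left_mono) auto
      then show "f q \<le> of_bool (real (deep_count (k' * i + k') (m + j) q) < \<theta> * ?a)"
        by (auto simp: f_def)
    qed
    also have "\<dots> \<le> (real (m + j) / real m)\<^sup>2 / (\<delta>\<^sup>2 * ?a)"
      using m \<delta> mean[OF m(2)] False x by (intro evolve_deep_count) (auto simp: j_def)
    also have "real (m + j) / real m = real b" using m by (simp add: mj)
    also have "(real b)\<^sup>2 / (\<delta>\<^sup>2 * ?a) \<le> (real b)\<^sup>2 / (\<delta>\<^sup>2 * x)"
      using False x \<delta> by (intro divide_left_mono mult_left_mono mult_pos_pos) auto
    finally show ?thesis using False by simp
  qed
  then have step: "expectation (\<lambda>\<omega>. evolve m j f (hist m \<omega>)) \<le>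
      expectation (\<lambda>\<omega>. of_bool (real (deep_count (k' * i) m (hist m \<omega>)) < x) + (real b)\<^sup>2 / (\<delta>\<^sup>2 * x))"
    by (intro integral_mono integrable_hist
      integrable_hist[where f = "\<lambda>p. of_bool (real (deep_count (k' * i) m p) < x) + (real b)\<^sup>2 / (\<delta>\<^sup>2 * x)"])
  have "expectation (\<lambda>\<omega>. f (hist (m + j) \<omega>)) = expectation (\<lambda>\<omega>. evolve m j f (hist m \<omega>))"
    by (rule expectation_evolve[OF m(1)])
  also note step
  also have "expectation (\<lambda>\<omega>. of_bool (real (deep_count (k' * i) m (hist m \<omega>)) < x) + (real b)\<^sup>2 / (\<delta>\<^sup>2 * x)) =
      expectation (\<lambda>\<omega>. of_bool (real (deep_count (k' * i) m (hist m \<omega>)) < x)) + (real b)\<^sup>2 / (\<delta>\<^sup>2 * x)"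
    by (subst Bochner_Integration.integral_add)
       (auto intro: integrable_hist[where f = "\<lambda>p. of_bool (real (deep_count (k' * i) m p) < x)"] simp: prob_space)
  also have "\<dots> \<le> (\<Sum>l<Suc i. (real b)\<^sup>2 / (\<delta>\<^sup>2 * (real m\<^sub>0 * \<theta> ^ l)))"
    using Suc.IH by (simp add: m_def x_def)
  finally have "expectation (\<lambda>\<omega>. f (hist (m + j) \<omega>)) \<le> (\<Sum>l<Suc i. (real b)\<^sup>2 / (\<delta>\<^sup>2 * (real m\<^sub>0 * \<theta> ^ l)))" .
  moreover have "m + j = m\<^sub>0 * b ^ Suc i" unfolding mj by (simp add: m_def)
  moreover have "k' * i + k' = k' * Suc i" by simp
  moreover have "\<theta> * x = real m\<^sub>0 * \<theta> ^ Suc i" by (simp add: x_def)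
  ultimately show ?case unfolding f_def by (simp only:)
qed

text \<open>If the counts have grown in every block, some node has depth at least \<open>k' * i\<close>.  The
  geometric series makes the failure probability small in \<open>m\<^sub>0\<close>, uniformly in the number of blocks.\<close>

lemma prob_height_less:
  assumes b: "b \<ge> 1" and \<theta>: "\<theta> > 1" and \<delta>: "\<delta> > 0" and m\<^sub>0: "m\<^sub>0 \<ge> 1"
    and mean: "\<And>m. m \<ge> m\<^sub>0 \<Longrightarrow> mean_gen m ((b - 1) * m) k' \<ge> \<theta> + \<delta>"
    and n: "m\<^sub>0 * b ^ i \<le> n" and y: "y \<le> real (k' * i)" "y > 0"
  shows "prob {\<omega> \<in> space M. \<forall>l\<in>{1..n}. real (path_length par l \<omega>) < y}
    \<le> (real b)\<^sup>2 / \<delta>\<^sup>2 * (\<theta> / (\<theta> - 1)) / real m\<^sub>0"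
proof -
  let ?N = "m\<^sub>0 * b ^ i"
  have "prob {\<omega> \<in> space M. \<forall>l\<in>{1..n}. real (path_length par l \<omega>) < y} \<le>
      expectation (\<lambda>\<omega>. of_bool (real (deep_count (k' * i) ?N (hist ?N \<omega>)) < real m\<^sub>0 * \<theta> ^ i))"
  proof (rule markov_hist)
    fix \<omega> assume \<omega>: "\<omega> \<in> space M" and low: "\<forall>l\<in>{1..n}. real (path_length par l \<omega>) < y"
    have none: "\<not> k' * i \<le> depth (hist ?N \<omega>) v" if v: "v < ?N" for v
    proof (cases "v = 0")
      case True
      then show ?thesis using y by (cases "k' * i") auto
    next
      case False
      then have "v \<in> {1..n}" using v n by auto
      then have "real (path_length par v \<omega>) < real (k' * i)" using low y by fastforce
      then have "path_length par v \<omega> < k' * i" by (simp only: of_nat_less_iff)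
      then show ?thesis using path_length_eq_depth[OF \<omega> v] by simp
    qed
    then have "deep_count (k' * i) ?N (hist ?N \<omega>) = 0"
      unfolding deep_count_def by (auto simp: card_eq_0_iff)
    then show "of_bool (real (deep_count (k' * i) ?N (hist ?N \<omega>)) < real m\<^sub>0 * \<theta> ^ i) \<ge> (1::real)"
      using m\<^sub>0 \<theta> by simp
  qed simp
  also have "\<dots> \<le> (\<Sum>l<i. (real b)\<^sup>2 / (\<delta>\<^sup>2 * (real m\<^sub>0 * \<theta> ^ l)))"
    by (rule deep_count_growth) fact+
  also have "\<dots> = (real b)\<^sup>2 / \<delta>\<^sup>2 / real m\<^sub>0 * (\<Sum>l<i. (1 / \<theta>) ^ l)"
    unfolding sum_distrib_left by (intro sum.cong) (auto simp: power_divide)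
  also have "\<dots> \<le> (real b)\<^sup>2 / \<delta>\<^sup>2 / real m\<^sub>0 * (\<theta> / (\<theta> - 1))"
  proof (rule mult_left_mono)
    have "(\<Sum>l<i. (1 / \<theta>) ^ l) \<le> (\<Sum>l. (1 / \<theta>) ^ l)"
      using \<theta> by (intro sum_le_suminf summable_geometric) auto
    also have "\<dots> = \<theta> / (\<theta> - 1)"
      using \<theta> by (subst suminf_geometric) (auto simp: field_simps)
    finally show "(\<Sum>l<i. (1 / \<theta>) ^ l) \<le> \<theta> / (\<theta> - 1)" .
  qed simp
  finally show ?thesis by (simp add: mult_ac)
qed

text \<open>The slack between \<open>c\<close> and \<open>d\<close> pays for the part of \<open>ln n\<close> that is lost to the initial
  \<open>m\<^sub>0\<close> nodes and to the incomplete last block.\<close>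

lemma max_path_length_lower:
  fixes c :: real
  assumes c: "0 < c" "c < exp 1"
  shows "(\<lambda>n. prob {\<omega> \<in> space M. \<forall>l\<in>{1..n}. real (path_length par l \<omega>) < c * ln (real n)}) \<longlonglongrightarrow> 0"
proof (rule LIMSEQ_I)
  fix \<epsilon> :: real assume \<epsilon>: "\<epsilon> > 0"
  obtain d where d: "c < d" "d < exp 1" using dense[OF c(2)] by blast
  obtain b k' where b: "b \<ge> 2" "d * ln (real b) \<le> real k'" "ln (real b) ^ k' / fact k' > 1"
    using block_exists[of d] c d by auto
  have b1: "b \<ge> 1" using b by simp
  obtain \<theta> \<delta> m\<^sub>1 where \<theta>: "\<theta> > 1" and \<delta>: "\<delta> > 0"
    and m\<^sub>1: "\<And>m. m \<ge> m\<^sub>1 \<Longrightarrow> mean_gen m ((b - 1) * m) k' \<ge> \<theta> + \<delta>"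
    using mean_gen_block[OF b1 b(3)] by blast
  define C where "C = (real b)\<^sup>2 / \<delta>\<^sup>2 * (\<theta> / (\<theta> - 1))"
  define m\<^sub>0 where "m\<^sub>0 = max (max 1 m\<^sub>1) (nat \<lceil>C / \<epsilon>\<rceil> + 1)"
  have m\<^sub>0: "m\<^sub>0 \<ge> 1" "m\<^sub>0 \<ge> m\<^sub>1" by (auto simp: m\<^sub>0_def)
  have "C / \<epsilon> < real (nat \<lceil>C / \<epsilon>\<rceil> + 1)" by linarith
  also have "\<dots> \<le> real m\<^sub>0" unfolding m\<^sub>0_def of_nat_le_iff by simp
  finally have small: "C / real m\<^sub>0 < \<epsilon>" using \<epsilon> m\<^sub>0 by (simp add: field_simps)
  define T where "T = ln (real b)"
  have T: "T > 0" using b by (simp add: T_def)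
  \<comment> \<open>From \<open>ln n = K\<close> on, \<open>c * ln n\<close> is below \<open>d\<close> times the length \<open>ln n - ln m\<^sub>0 - T\<close> of the
     complete blocks on the logarithmic scale.\<close>
  define K where "K = d * (ln (real m\<^sub>0) + T) / (d - c)"
  have "filterlim (\<lambda>n. ln (real n)) at_top sequentially"
    by (intro filterlim_compose[OF ln_at_top] filterlim_real_sequentially)
  then have "\<forall>\<^sub>F n in sequentially. ln (real n) \<ge> max K (ln (real m\<^sub>0) + T)"
    by (simp only: filterlim_at_top)
  moreover have "\<forall>\<^sub>F n in sequentially. n \<ge> (2::nat)" by (rule eventually_ge_at_top)
  ultimately have "\<forall>\<^sub>F n in sequentially.
      norm (prob {\<omega> \<in> space M. \<forall>l\<in>{1..n}. real (path_length par l \<omega>) < c * ln (real n)} - 0) < \<epsilon>"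
  proof eventually_elim
    case (elim n)
    define L where "L = ln (real n)"
    define x where "x = L - ln (real m\<^sub>0)"
    define i where "i = nat \<lfloor>x / T\<rfloor>"
    have L: "L \<ge> K" "x \<ge> T" using elim(1) by (auto simp: L_def x_def)
    have xT: "x / T \<ge> 1" using L T by simp
    have i_le: "real i \<le> x / T" and i_ge: "real i \<ge> x / T - 1"
      using xT unfolding i_def by linarith+
    have "ln (real (m\<^sub>0 * b ^ i)) = ln (real m\<^sub>0) + real i * T"
      using m\<^sub>0 b by (simp add: ln_mult ln_realpow T_def)
    also have "\<dots> \<le> L" using i_le T by (simp add: field_simps x_def)
    finally have "real (m\<^sub>0 * b ^ i) \<le> real n"
      unfolding L_def using m\<^sub>0 b elim(2)
      by (intro ln_le_cancel_iff[THEN iffD1, of "real (m\<^sub>0 * b ^ i)" "real n"]) auto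
    then have "m\<^sub>0 * b ^ i \<le> n" by (simp only: of_nat_le_iff)
    moreover have "c * L \<le> real (k' * i)"
    proof -
      have "c * L \<le> d * (x - T)"
        using L(1) d by (simp add: K_def x_def field_simps)
      also have "\<dots> = d * T * (x / T - 1)" using T by (simp add: field_simps)
      also have "\<dots> \<le> real k' * real i"
        using b(2) i_ge xT by (intro mult_mono) (auto simp: T_def)
      finally show ?thesis by simp
    qed
    moreover have "c * L > 0" using c elim(2) by (simp add: L_def)
    ultimately have "prob {\<omega> \<in> space M. \<forall>l\<in>{1..n}. real (path_length par l \<omega>) < c * L} \<le> C / real m\<^sub>0"
      unfolding C_def using b1 \<theta> \<delta> m\<^sub>0 m\<^sub>1 by (intro prob_height_less[where k' = k' and i = i]) auto
    then show ?case using small by (simp add: L_def)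
  qed
  then show "\<exists>no. \<forall>n\<ge>no. norm (prob {\<omega> \<in> space M. \<forall>l\<in>{1..n}. real (path_length par l \<omega>) < c * ln (real n)} - 0) < \<epsilon>"
    by (simp only: eventually_sequentially)
qed

end

section \<open>Maximum and conclusion\<close>

lemma real_Max_less_iff:
  assumes "finite I" "I \<noteq> {}"
  shows "real (MAX l\<in>I. f l) < y \<longleftrightarrow> (\<forall>l\<in>I. real (f l) < y)"
    and "y < real (MAX l\<in>I. f l) \<longleftrightarrow> (\<exists>l\<in>I. y < real (f l))"
proof -
  have "Max (f ` I) \<in> f ` I"
    using assms by (intro Max_in) auto
  then obtain i where i: "i \<in> I" "(MAX l\<in>I. f l) = f i"
    by blast
  have "real (f l) \<le> real (f i)" if "l \<in> I" for l
    using Max_ge[of "f ` I" "f l"] assms that by (simp add: i(2))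
  then show "real (MAX l\<in>I. f l) < y \<longleftrightarrow> (\<forall>l\<in>I. real (f l) < y)"
    and "y < real (MAX l\<in>I. f l) \<longleftrightarrow> (\<exists>l\<in>I. y < real (f l))"
    unfolding i(2) using i(1) by (meson le_less_trans less_le_trans)+
qed

context first_parent_tree begin

lemma max_path_length_over_ln_converges:
  "converges_in_prob M (\<lambda>n \<omega>. real (MAX l\<in>{1..n}. path_length par l \<omega>) / ln (real n)) (exp 1)"
proof (rule converges_in_probI)
  fix n
  have "(\<lambda>\<omega>. real (MAX l\<in>{1..n}. depth (hist (Suc n) \<omega>) l) / ln (real n)) \<in> borel_measurable M"
    by (rule borel_measurable_integrable[OF
          integrable_hist[where f = "\<lambda>q. real (MAX l\<in>{1..n}. depth q l) / ln (real n)"]])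
  moreover have "(MAX l\<in>{1..n}. path_length par l \<omega>) = (MAX l\<in>{1..n}. depth (hist (Suc n) \<omega>) l)"
    if "\<omega> \<in> space M" for \<omega>
    using path_length_eq_depth[OF that] by (intro arg_cong[where f = Max] image_cong) auto
  ultimately show "(\<lambda>\<omega>. real (MAX l\<in>{1..n}. path_length par l \<omega>) / ln (real n)) \<in> borel_measurable M"
    by (subst measurable_cong) auto
next
  fix \<epsilon> :: real assume "\<epsilon> > 0"
  then have "(\<lambda>n. prob {\<omega> \<in> space M. \<exists>l\<in>{1..n}. real (path_length par l \<omega>) > (exp 1 + \<epsilon>) * ln (real n)}) \<longlonglongrightarrow> 0"
    by (intro max_path_length_upper) simp
  moreover have "\<forall>\<^sub>F n in sequentially.
      prob {\<omega> \<in> space M. \<exists>l\<in>{1..n}. real (path_length par l \<omega>) > (exp 1 + \<epsilon>) * ln (real n)} =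
      prob {\<omega> \<in> space M. exp 1 + \<epsilon> < real (MAX l\<in>{1..n}. path_length par l \<omega>) / ln (real n)}"
    using eventually_ge_at_top[of 2]
    by eventually_elim (simp add: pos_less_divide_eq real_Max_less_iff)
  ultimately show "(\<lambda>n. prob {\<omega> \<in> space M. exp 1 + \<epsilon> <
      real (MAX l\<in>{1..n}. path_length par l \<omega>) / ln (real n)}) \<longlonglongrightarrow> 0"
    by (rule Lim_transform_eventually)
next
  fix \<epsilon> :: real assume "\<epsilon> > 0" "\<epsilon> < exp 1"
  then have "(\<lambda>n. prob {\<omega> \<in> space M. \<forall>l\<in>{1..n}. real (path_length par l \<omega>) < (exp 1 - \<epsilon>) * ln (real n)}) \<longlonglongrightarrow> 0"
    by (intro max_path_length_lower) auto
  moreover have "\<forall>\<^sub>F n in sequentially.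
      prob {\<omega> \<in> space M. \<forall>l\<in>{1..n}. real (path_length par l \<omega>) < (exp 1 - \<epsilon>) * ln (real n)} =
      prob {\<omega> \<in> space M. real (MAX l\<in>{1..n}. path_length par l \<omega>) / ln (real n) < exp 1 - \<epsilon>}"
    using eventually_ge_at_top[of 2]
    by eventually_elim (simp add: pos_divide_less_eq real_Max_less_iff)
  ultimately show "(\<lambda>n. prob {\<omega> \<in> space M.
      real (MAX l\<in>{1..n}. path_length par l \<omega>) / ln (real n) < exp 1 - \<epsilon>}) \<longlonglongrightarrow> 0"
    by (rule Lim_transform_eventually)
qed simp

end

theorem theorem1:
  fixes M :: "'a measure" and k :: nat and par :: "nat \<Rightarrow> nat \<Rightarrow> 'a \<Rightarrow> nat"
  assumes "k \<ge> 1"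
    and "uniform_random_kdag M k par"
  shows "converges_in_prob M (\<lambda>n \<omega>. real (path_length par n \<omega>) / ln (real n)) 1
    \<and> converges_in_prob M
        (\<lambda>n \<omega>. real (MAX l\<in>{1..n}. path_length par l \<omega>) / ln (real n)) (exp 1)
    \<and> (\<lambda>n. measure M {\<omega> \<in> space M.
          (MIN l\<in>{l. real n / 2 \<le> real l \<and> l \<le> n}. path_length par l \<omega>) \<le> 2}) \<longlonglongrightarrow> 1
    \<and> (\<forall>n\<ge>2. \<forall>t::int. ln (real n) \<le> real_of_int t \<longrightarrow>
          measure M {\<omega> \<in> space M. int (path_length par n \<omega>) > t}
            \<le> exp (real_of_int t - ln (real n)
                   - real_of_int t * ln (real_of_int t / ln (real n))))"
proof -
  interpret first_parent_tree M k par
    using assms by (simp add: first_parent_tree_def first_parent_tree_axioms_def)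
  show ?thesis
    using path_length_over_ln_converges max_path_length_over_ln_converges
      min_path_length_le_2 path_length_tail by blast
qed

end
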